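(* Let $0<\delta\le 1$ be any constant. Let $\mathcal{T}_1,\mathcal{T}_2,\mathcal{T}_3\subset\mathbb{C}^n$ be disjoint finite subsets that form a $\delta$-EK configuration. Then $$\dim\big(\mathrm{span}\{\mathcal{T}_1\cup\mathcal{T}_2\cup\mathcal{T}_3\}\big)\le O(1/\delta^3).$$
   Context: The sets $\mathcal{T}_1,\mathcal{T}_2,\mathcal{T}_3\subset\mathbb{C}^n$ form a $\delta$-EK configuration if for every $i\in\{1,2,3\}$ and $p\in\mathcal{T}_i$, and for every $j\in\{1,2,3\}\setminus\{i\}$, at least a $\delta$ fraction of the points $p_j\in\mathcal{T}_j$ satisfy that $p$ and $p_j$ span some point in the third set (the set $\mathcal{T}_k$ with $\{i,j,k\}=\{1,2,3\}$). The constant hidden in $O(\cdot)$ is absolute. *)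

theory Defs
  imports Complex_Main "HOL-Library.Disjoint_Sets" "Jordan_Normal_Form.DL_Rank"
begin

text \<open>
  The space \<open>\<complex>\<^sup>n\<close> is \<open>carrier_vec n\<close> at element type \<open>complex\<close>, with \<open>n\<close> a term rather than
  a type, so that a constant can be quantified before \<open>n\<close>.
\<close>

definition (in vec_space) span_dim :: "'a vec set \<Rightarrow> nat" where
  "span_dim S = vectorspace.dim class_ring (span_vs S)"

text \<open>
  The set spanned by two points is the affine span, i.e. the complex line through them (as in the
  theorem of Edelstein and Kelly, and in contrast to the dimension of the configuration, which is
  that of a linear span). The two-dimensional linear span would not do:
  \<open>T i = {i \<cdot>\<^sub>v v | v \<in> B}\<close> for a basis \<open>B\<close> would satisfy the condition with \<open>\<delta> = 1\<close>.
\<close>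

definition line_through :: "complex vec \<Rightarrow> complex vec \<Rightarrow> complex vec set" where
  "line_through p q = {p + c \<cdot>\<^sub>v (q - p) | c. True}"

text \<open>
  No fraction of the points of an empty set is defined. As \<open>0 / 0 = 0\<close>, a configuration with
  \<open>\<delta> > 0\<close> has \<open>T 1\<close>, \<open>T 2\<close>, \<open>T 3\<close> all nonempty, or else all empty. Reading the condition as
  \<open>card {...} \<ge> \<delta> * card (T j)\<close> would instead allow an arbitrary \<open>T 1\<close> with \<open>T 2 = T 3 = {}\<close>.
\<close>

definition EK_configuration :: "real \<Rightarrow> (nat \<Rightarrow> complex vec set) \<Rightarrow> bool" where
  "EK_configuration \<delta> T \<longleftrightarrow>
    (\<forall>i\<in>{1,2,3}. \<forall>p\<in>T i. \<forall>j\<in>{1,2,3} - {i}. \<forall>k. {i, j, k} = {1,2,3} \<longrightarrow>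
      real (card {q \<in> T j. \<exists>r\<in>T k. r \<in> line_through p q}) / real (card (T j)) \<ge> \<delta>)"

end

theory Submission
  imports Defs "HOL-Analysis.Convex"
begin

text \<open>
  Let \<open>T\<close> be the whole configuration. Choose a maximal linearly independent \<open>B \<subseteq> T\<close> and expand the
  points of \<open>T\<close> in it. Each \<open>b \<in> B\<close> gives a coordinate function \<open>T \<rightarrow> \<complex>\<close>, these \<open>card B\<close> functions
  are independent, and each of them satisfies every linear relation that holds between the points. So
  it is enough to show that the relations carried by collinear triples have few independent
  solutions: a rank bound for a matrix with three nonzero entries in each row.

  \<^item> Rank bound (\<open>weighted_design_bound\<close>). Give row \<open>r\<close> a weight \<open>w r\<close> and let \<open>c i\<close> be a third of
    the total weight of the rows through \<open>i\<close>. Rows and columns can be rescaled so that the weighted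
    column norms become the \<open>c i\<close> up to an arbitrarily small error (\<open>scaling_columns\<close>). The solutions
    are then fixed by \<open>G = I - M\<close>, where \<open>M\<close> is the normalised Gram matrix of the columns; \<open>G\<close>
    has almost zero diagonal, and its off-diagonal entries are small as soon as no pair \<open>i, j\<close> lies in
    rows of total weight more than \<open>\<kappa> * c i * c j\<close>. A space of functions fixed by \<open>G\<close> has dimension at
    most the squared Frobenius norm of \<open>G\<close> (\<open>card_fixed_family_le\<close>), which up to the scaling error is
    at most \<open>\<kappa> * (\<Sum>r. w r)\<close>.

  \<^item> Choice of weights (\<open>linear_space_rank_bound\<close>). Put masses \<open>\<mu>\<close> on the points and give a triple on
    a line \<open>\<ll>\<close> the weight \<open>\<mu> i * \<mu> j * \<mu> k / \<mu>(\<ll>)\<close>. The rows through a pair then have total weight at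
    most \<open>\<mu> i * \<mu> j\<close>, however many points lie on the line, and the degree of \<open>i\<close> is at least a constant
    times \<open>\<mu> i\<close> times the mass of those \<open>j\<close> for which a fixed fraction of \<open>\<mu>(\<ll>)\<close> lies outside
    \<open>{i, j}\<close>.

  \<^item> Unequal colours (\<open>dominant_colour_bound\<close>). The three sets may have very different sizes. Let \<open>A\<close>
    be a largest one and \<open>D\<close> the union of the other two, and give \<open>A\<close> and \<open>D\<close> mass 1 each, spread
    uniformly. As \<open>card D \<le> 2 * card A\<close>, a point of \<open>A\<close> is at most twice as heavy as a point of \<open>D\<close>.
    A line that meets all three colours contains two points of \<open>D\<close>, so a pair from \<open>A \<times> D\<close> never carries
    more than three quarters of it. The hypothesis says that each point is joined by such lines to a
    mass \<open>\<delta>\<close> on the other side.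

  Altogether the dimension is at most \<open>384 / \<delta>\<^sup>2\<close>, which is at most \<open>384 / \<delta> ^ 3\<close> for \<open>\<delta> \<le> 1\<close>.
\<close>

section \<open>Approximate scaling of the columns of a weighted hypergraph\<close>

text \<open>
  In a uniform hypergraph the target column sums, in which every edge spreads its weight equally over
  its vertices, can be approached for all positive entries. The required scaling is an approximate
  critical point of \<open>f x = (\<Sum>r. w r * (ln (\<Sum>j. A r j * x j) - (\<Sum>j. ln (x j)) / q))\<close>: the derivative of
  \<open>f\<close> in \<open>ln (x i)\<close> is the error in column \<open>i\<close>. The infimum of \<open>f\<close> need not be attained, but \<open>f\<close> is bounded
  below since a sum of positive numbers is at least the geometric mean of its terms, and at a point where
  \<open>f\<close> is close to its infimum no coordinate can have a large derivative.
\<close>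

lemma scaling_columns:
  fixes w :: "'r \<Rightarrow> real" and e :: "'r \<Rightarrow> 'a set" and A :: "'r \<Rightarrow> 'a \<Rightarrow> real"
  assumes finR: "finite R"
    and e: "\<And>r. r \<in> R \<Longrightarrow> finite (e r) \<and> card (e r) = q" and q: "q > 0"
    and w: "\<And>r. r \<in> R \<Longrightarrow> w r \<ge> 0"
    and A: "\<And>r i. r \<in> R \<Longrightarrow> i \<in> e r \<Longrightarrow> A r i > 0"
    and eps: "\<epsilon> > 0"
  shows "\<exists>x. (\<forall>i. x i > 0) \<and>
    (\<forall>i. \<bar>\<Sum>r | r \<in> R \<and> i \<in> e r. w r * (A r i * x i / (\<Sum>j\<in>e r. A r j * x j) - 1 / real q)\<bar> \<le> \<epsilon>)"
proof -
  define S where "S x r = (\<Sum>j\<in>e r. A r j * x j)" for x :: "'a \<Rightarrow> real" and r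
  define f where "f x = (\<Sum>r\<in>R. w r * (ln (S x r) - (1 / real q) * (\<Sum>j\<in>e r. ln (x j))))" for x
  define P where "P = {x :: 'a \<Rightarrow> real. \<forall>i. x i > 0}"
  have Spos: "S x r > 0" if "x \<in> P" "r \<in> R" for x r
  proof -
    have "e r \<noteq> {}" using e[OF that(2)] q by auto
    then show ?thesis unfolding S_def using that e A by (intro sum_pos) (auto simp: P_def)
  qed
  define L where "L = (\<Sum>r\<in>R. w r * ((1 / real q) * (\<Sum>j\<in>e r. ln (A r j))))"
  have below: "L \<le> f x" if x: "x \<in> P" for x
    unfolding L_def f_def
  proof (intro sum_mono mult_left_mono w)
    fix r assume r: "r \<in> R"
    have "ln (A r j) + ln (x j) \<le> ln (S x r)" if j: "j \<in> e r" for j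
    proof -
      have pos: "A r j > 0" "x j > 0" using A r j x by (auto simp: P_def)
      have "A r j * x j \<le> S x r" unfolding S_def
        by (rule member_le_sum) (use j r e A x in \<open>auto simp: P_def less_imp_le\<close>)
      then have "ln (A r j * x j) \<le> ln (S x r)"
        using pos Spos[OF x r] by simp
      then show ?thesis using pos by (simp add: ln_mult)
    qed
    then have "(\<Sum>j\<in>e r. ln (A r j) + ln (x j)) \<le> (\<Sum>j\<in>e r. ln (S x r))" by (rule sum_mono)
    also have "\<dots> = real q * ln (S x r)" using e[OF r] by simp
    finally have "(\<Sum>j\<in>e r. ln (A r j)) + (\<Sum>j\<in>e r. ln (x j)) \<le> real q * ln (S x r)"
      by (simp add: sum.distrib)
    then show "1 / real q * (\<Sum>j\<in>e r. ln (A r j)) \<le> ln (S x r) - 1 / real q * (\<Sum>j\<in>e r. ln (x j))"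
      using q by (simp add: field_simps)
  qed
  have P1: "(\<lambda>_. 1) \<in> P" by (simp add: P_def)
  have bdd: "bdd_below (f ` P)" using below by (auto intro!: bdd_belowI)
  define W where "W = (\<Sum>r\<in>R. w r)"
  define W' where "W' = 2 * W + 1 + \<epsilon>"
  have W0: "W \<ge> 0" unfolding W_def by (simp add: sum_nonneg w)
  have W'0: "W' > 0" "W' \<ge> 1 + \<epsilon>" using W0 eps by (auto simp: W'_def)
  define \<eta> where "\<eta> = \<epsilon>\<^sup>2 / (4 * W')"
  have "\<eta> > 0" using eps W'0 by (simp add: \<eta>_def)
  have "\<exists>y\<in>f ` P. y < Inf (f ` P) + \<eta>"
    using cInf_lessD[of "f ` P" "Inf (f ` P) + \<eta>"] P1 \<open>\<eta> > 0\<close> by auto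
  then obtain x where x: "x \<in> P" "f x < Inf (f ` P) + \<eta>" by auto
  have near: "f x - \<eta> < f y" if "y \<in> P" for y
    using cInf_lower[OF imageI[OF that] bdd] x(2) by linarith
  define g where "g i = (\<Sum>r | r \<in> R \<and> i \<in> e r. w r * (A r i * x i / S x r - 1 / real q))" for i
  \<comment> \<open>Multiplying \<open>x i\<close> by \<open>1 + h\<close> adds at most the right-hand side to \<open>f\<close>, and \<open>x\<close> is too close to
    the infimum for \<open>f\<close> to drop by \<open>\<eta>\<close>.\<close>
  have step: "- \<eta> < h * g i + 2 * h\<^sup>2 * W" if h: "\<bar>h\<bar> \<le> 1/2" for h i
  proof -
    define y where "y = x(i := x i * (1 + h))"
    have h1: "1 + h > 0" using h by linarith
    have yP: "y \<in> P" using x(1) h1 by (auto simp: P_def y_def)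
    have ln_h: "h - 2 * h\<^sup>2 \<le> ln (1 + h)"
      using abs_ln_one_plus_x_minus_x_bound[OF h] by (simp add: abs_le_iff)
    let ?t = "\<lambda>x r. w r * (ln (S x r) - (1 / real q) * (\<Sum>j\<in>e r. ln (x j)))"
    have diff: "?t y r - ?t x r \<le> (if i \<in> e r then h * (w r * (A r i * x i / S x r - 1 / real q)) else 0) + 2 * h\<^sup>2 * w r"
      if r: "r \<in> R" for r
    proof (cases "i \<in> e r")
      case False
      then have "S y r = S x r" "(\<Sum>j\<in>e r. ln (y j)) = (\<Sum>j\<in>e r. ln (x j))"
        unfolding S_def y_def by (auto intro!: sum.cong)
      then show ?thesis using False w[OF r] by simp
    next
      case True
      have fe: "finite (e r)" using e[OF r] by simp
      define p where "p = A r i * x i / S x r"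
      have Sx: "S x r > 0" using Spos x r by auto
      have p0: "p > 0" unfolding p_def using A[OF r True] x(1) Sx by (auto simp: P_def)
      have p1: "p \<le> 1"
      proof -
        have "A r i * x i \<le> S x r" unfolding S_def
          by (rule member_le_sum) (use True r e A x in \<open>auto simp: P_def less_imp_le\<close>)
        then show ?thesis using Sx by (simp add: p_def)
      qed
      have "S y r = S x r + A r i * x i * h"
        unfolding S_def using True fe
        by (simp add: sum.remove[OF fe True] y_def algebra_simps)
      also have "\<dots> = S x r * (1 + p * h)"
        using Sx by (simp add: p_def field_simps)
      finally have Sy: "S y r = S x r * (1 + p * h)" .
      have "1 + p * h > 0"
        using Sy Spos[OF yP r] Sx by (simp add: zero_less_mult_iff)
      then have lnS: "ln (S y r) \<le> ln (S x r) + p * h"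
        using Sx ln_add_one_self_le_self2[of "p * h"] by (simp add: Sy ln_mult)
      have lns: "(\<Sum>j\<in>e r. ln (y j)) = (\<Sum>j\<in>e r. ln (x j)) + ln (1 + h)"
      proof -
        have "(\<Sum>j\<in>e r - {i}. ln (y j)) = (\<Sum>j\<in>e r - {i}. ln (x j))"
          by (auto intro!: sum.cong simp: y_def)
        moreover have "ln (y i) = ln (x i) + ln (1 + h)"
          using x(1) h1 less_imp_neq[of 0 "x i"] by (auto simp: y_def P_def ln_mult)
        ultimately show ?thesis by (simp add: sum.remove[OF fe True])
      qed
      have "(1 / real q) * ln (1 + h) \<ge> (1 / real q) * (h - 2 * h\<^sup>2)"
        using ln_h by (intro mult_left_mono) auto
      moreover have "(1 / real q) * (2 * h\<^sup>2) \<le> 1 * (2 * h\<^sup>2)"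
        using q by (intro mult_right_mono) auto
      ultimately have "(1 / real q) * ln (1 + h) \<ge> (1 / real q) * h - 2 * h\<^sup>2"
        by (simp add: right_diff_distrib)
      then have "(ln (S y r) - (1 / real q) * (\<Sum>j\<in>e r. ln (y j)))
          - (ln (S x r) - (1 / real q) * (\<Sum>j\<in>e r. ln (x j))) \<le> h * (p - 1 / real q) + 2 * h\<^sup>2"
        using lnS unfolding lns by (simp add: algebra_simps)
      from mult_left_mono[OF this w[OF r]] show ?thesis
        using True by (simp add: p_def algebra_simps)
    qed
    have "f y - f x = (\<Sum>r\<in>R. ?t y r - ?t x r)" unfolding f_def by (simp add: sum_subtractf)
    also have "\<dots> \<le> (\<Sum>r\<in>R. (if i \<in> e r then h * (w r * (A r i * x i / S x r - 1 / real q)) else 0) + 2 * h\<^sup>2 * w r)"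
      by (rule sum_mono) (rule diff)
    also have "\<dots> = h * g i + 2 * h\<^sup>2 * W"
      unfolding sum.distrib g_def W_def sum_distrib_left
      using finR by (simp add: sum.inter_filter)
    finally show ?thesis using near[OF yP] by linarith
  qed
  have "\<bar>g i\<bar> \<le> \<epsilon>" for i
  proof (rule ccontr)
    assume "\<not> \<bar>g i\<bar> \<le> \<epsilon>"
    then have gi: "\<bar>g i\<bar> > \<epsilon>" by simp
    \<comment> \<open>With this step length the linear gain \<open>s * \<epsilon> = 2 * \<eta>\<close> exceeds the quadratic loss by at
    least \<open>\<eta>\<close>.\<close>
    define s where "s = \<epsilon> / (2 * W')"
    have s0: "s > 0" using eps W'0 by (simp add: s_def)
    have s1: "s \<le> 1/2" using eps W'0 by (simp add: s_def divide_simps)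
    define h where "h = - sgn (g i) * s"
    have habs: "\<bar>h\<bar> = s" and hg: "h * g i = - s * \<bar>g i\<bar>" and h2: "h\<^sup>2 = s\<^sup>2"
      using gi eps s0 by (auto simp: h_def sgn_if abs_mult)
    have "- \<eta> < - s * \<bar>g i\<bar> + 2 * s\<^sup>2 * W" using step[of h i] habs hg h2 s1 by simp
    moreover have "s * \<epsilon> \<le> s * \<bar>g i\<bar>" using gi s0 by simp
    moreover have "2 * s\<^sup>2 * W \<le> s\<^sup>2 * W'"
      using eps W0 by (simp add: W'_def algebra_simps)
    moreover have "s\<^sup>2 * W' = \<eta>" "s * \<epsilon> = 2 * \<eta>"
      using W'0 by (simp_all add: s_def \<eta>_def power2_eq_square field_simps)
    ultimately show False by linarith
  qed
  then show ?thesis using x(1) unfolding g_def S_def P_def by blast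
qed

section \<open>Functions fixed by a matrix of small Frobenius norm\<close>

definition cinner_on :: "'a set \<Rightarrow> ('a \<Rightarrow> complex) \<Rightarrow> ('a \<Rightarrow> complex) \<Rightarrow> complex" where
  "cinner_on T f g = (\<Sum>i\<in>T. f i * cnj (g i))"

text \<open>
  The restrictions to \<open>T\<close> are taken as an indexed family: coinciding members count as a dependence, so
  \<open>card B\<close> is the dimension of their span.
\<close>

definition independent_family :: "'a set \<Rightarrow> 'b set \<Rightarrow> ('b \<Rightarrow> 'a \<Rightarrow> complex) \<Rightarrow> bool" where
  "independent_family T B f \<longleftrightarrow>
    (\<forall>t. (\<forall>i\<in>T. (\<Sum>b\<in>B. t b * f b i) = 0) \<longrightarrow> (\<forall>b\<in>B. t b = 0))"

text \<open>
  Gram-Schmidt orthonormalisation; the coefficients \<open>s\<close> record that the new family consists of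
  combinations of the old one.
\<close>

lemma orthonormal_family_exists:
  assumes finT: "finite T" and "finite B" and "independent_family T B f"
  shows "\<exists>e s. (\<forall>b\<in>B. \<forall>i. e b i = (\<Sum>b'\<in>B. s b b' * f b' i)) \<and>
    (\<forall>b\<in>B. \<forall>b'\<in>B. cinner_on T (e b) (e b') = (if b = b' then 1 else 0))"
  using assms(2,3)
proof (induction B rule: finite_induct)
  case empty
  then show ?case by simp
next
  case (insert a B)
  have "independent_family T B f"
    unfolding independent_family_def
  proof (intro allI impI)
    fix t assume t: "\<forall>i\<in>T. (\<Sum>b\<in>B. t b * f b i) = 0"
    let ?t = "t(a := 0)"
    have "(\<Sum>b\<in>B. ?t b * f b i) = (\<Sum>b\<in>B. t b * f b i)" for i
      using insert(2) by (intro sum.cong) auto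
    then have "\<forall>i\<in>T. (\<Sum>b\<in>insert a B. ?t b * f b i) = 0"
      using insert(1,2) t by simp
    then have "\<forall>b\<in>insert a B. ?t b = 0"
      using insert.prems unfolding independent_family_def by blast
    then show "\<forall>b\<in>B. t b = 0" using insert(2) by (metis fun_upd_other insertCI)
  qed
  from insert.IH[OF this] obtain e s where
    es: "\<And>b i. b \<in> B \<Longrightarrow> e b i = (\<Sum>b'\<in>B. s b b' * f b' i)" and
    on: "\<And>b b'. b \<in> B \<Longrightarrow> b' \<in> B \<Longrightarrow> cinner_on T (e b) (e b') = (if b = b' then 1 else 0)"
    by blast
  define y where "y i = f a i - (\<Sum>b\<in>B. cinner_on T (f a) (e b) * e b i)" for i
  define ty where "ty b' = (if b' = a then 1 else - (\<Sum>b\<in>B. cinner_on T (f a) (e b) * s b b'))" for b'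
  have y_comb: "y i = (\<Sum>b'\<in>insert a B. ty b' * f b' i)" for i
  proof -
    have "(\<Sum>b\<in>B. cinner_on T (f a) (e b) * e b i) = (\<Sum>b\<in>B. \<Sum>b'\<in>B. cinner_on T (f a) (e b) * (s b b' * f b' i))"
      by (simp add: es sum_distrib_left)
    also have "\<dots> = (\<Sum>b'\<in>B. \<Sum>b\<in>B. cinner_on T (f a) (e b) * (s b b' * f b' i))" by (rule sum.swap)
    also have "\<dots> = (\<Sum>b'\<in>B. (\<Sum>b\<in>B. cinner_on T (f a) (e b) * s b b') * f b' i)"
      by (simp add: sum_distrib_right mult.assoc)
    also have "\<dots> = - (\<Sum>b'\<in>B. ty b' * f b' i)"
      using insert(2) by (auto simp: ty_def sum_negf simp flip: sum_negf intro!: sum.cong) (simp add: sum_negf)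
    finally show ?thesis using insert(1,2) by (simp add: y_def ty_def)
  qed
  have y_orth: "cinner_on T y (e b) = 0" if b: "b \<in> B" for b
  proof -
    have "(\<Sum>i\<in>T. (\<Sum>b'\<in>B. cinner_on T (f a) (e b') * e b' i) * cnj (e b i))
        = (\<Sum>b'\<in>B. cinner_on T (f a) (e b') * cinner_on T (e b') (e b))"
      unfolding sum_distrib_right
      by (subst sum.swap) (simp add: cinner_on_def sum_distrib_left mult.assoc)
    also have "\<dots> = cinner_on T (f a) (e b)"
    proof -
      have "(\<Sum>b'\<in>B. cinner_on T (f a) (e b') * cinner_on T (e b') (e b)) = (\<Sum>b'\<in>B. if b = b' then cinner_on T (f a) (e b') else 0)"
        by (intro sum.cong) (use on b in auto)
      then show ?thesis using b insert(1) by simp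
    qed
    finally show ?thesis
      unfolding cinner_on_def[of T y] y_def
      by (simp add: left_diff_distrib sum_subtractf) (simp add: cinner_on_def)
  qed
  define N where "N = (\<Sum>i\<in>T. (cmod (y i))\<^sup>2)"
  have yy: "cinner_on T y y = complex_of_real N"
    unfolding cinner_on_def N_def by (simp add: complex_norm_square[symmetric])
  have "N > 0"
  proof -
    have "\<not> (\<forall>i\<in>T. y i = 0)"
    proof
      assume "\<forall>i\<in>T. y i = 0"
      then have "\<forall>i\<in>T. (\<Sum>b'\<in>insert a B. ty b' * f b' i) = 0" using y_comb by metis
      then have "\<forall>b'\<in>insert a B. ty b' = 0"
        using insert.prems unfolding independent_family_def by blast
      then show False by (simp add: ty_def)
    qed
    then show ?thesis
      unfolding N_def using finT
      by (metis (no_types, lifting) norm_eq_zero power2_less_0 sum_pos2 zero_le_power2 zero_less_norm_iff zero_less_power)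
  qed
  define k where "k = complex_of_real (1 / sqrt N)"
  define e' where "e' b = (if b = a then (\<lambda>i. k * y i) else e b)" for b
  define s' where "s' b b' = (if b = a then k * ty b' else if b' = a then 0 else s b b')" for b b'
  have kk: "k * cnj k * complex_of_real N = 1"
    using \<open>N > 0\<close> unfolding k_def
    by (simp flip: of_real_mult of_real_divide)
  have c1: "\<forall>b\<in>insert a B. \<forall>i. e' b i = (\<Sum>b'\<in>insert a B. s' b b' * f b' i)"
  proof (intro ballI allI)
    fix b i assume "b \<in> insert a B"
    show "e' b i = (\<Sum>b'\<in>insert a B. s' b b' * f b' i)"
    proof (cases "b = a")
      case True
      then show ?thesis unfolding e'_def s'_def
        by (simp add: y_comb sum_distrib_left mult.assoc del: sum.insert)
    next
      case False
      then have "b \<in> B" using \<open>b \<in> insert a B\<close> by simp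
      moreover have "(\<Sum>b'\<in>B. s' b b' * f b' i) = (\<Sum>b'\<in>B. s b b' * f b' i)"
        using False insert(2) by (intro sum.cong) (auto simp: s'_def)
      ultimately show ?thesis using False insert(1,2) by (simp add: e'_def es s'_def)
    qed
  qed
  have sc: "cinner_on T (\<lambda>i. k * y i) g = k * cinner_on T y g" for g
    by (simp add: cinner_on_def sum_distrib_left mult.assoc)
  have sc2: "cinner_on T g (\<lambda>i. k * y i) = cnj k * cinner_on T g y" for g
    by (simp add: cinner_on_def sum_distrib_left algebra_simps)
  have "cinner_on T (e b) y = 0" if "b \<in> B" for b
  proof -
    have "cinner_on T (e b) y = cnj (cinner_on T y (e b))" by (simp add: cinner_on_def mult.commute)
    then show ?thesis using y_orth[OF that] by simp
  qed
  then have c2: "\<forall>b\<in>insert a B. \<forall>b'\<in>insert a B. cinner_on T (e' b) (e' b') = (if b = b' then 1 else 0)"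
    using on y_orth insert(2) kk by (auto simp: e'_def sc sc2 yy mult_ac)
  show ?case using c1 c2 by blast
qed

text \<open>
  If \<open>G\<close> fixes an orthonormal family \<open>e\<close>, then the inner products of row \<open>i\<close> of \<open>G\<close> with the family are the
  values \<open>e b i\<close>. Bessel's inequality for each row, summed over all rows, bounds the sum of the squared
  norms of the family, which is its size.
\<close>

lemma card_fixed_family_le:
  fixes G :: "'a \<Rightarrow> 'a \<Rightarrow> complex"
  assumes finT: "finite T" and finB: "finite B" and ind: "independent_family T B f"
    and fixG: "\<And>b i. b \<in> B \<Longrightarrow> i \<in> T \<Longrightarrow> (\<Sum>j\<in>T. G i j * f b j) = f b i"
  shows "real (card B) \<le> (\<Sum>i\<in>T. \<Sum>j\<in>T. (cmod (G i j))\<^sup>2)"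
proof -
  obtain e s where
    es: "\<And>b i. b \<in> B \<Longrightarrow> e b i = (\<Sum>b'\<in>B. s b b' * f b' i)" and
    on: "\<And>b b'. b \<in> B \<Longrightarrow> b' \<in> B \<Longrightarrow> cinner_on T (e b) (e b') = (if b = b' then 1 else 0)"
    using orthonormal_family_exists[OF finT finB ind] by blast
  have fixe: "(\<Sum>j\<in>T. G i j * e b j) = e b i" if "b \<in> B" "i \<in> T" for b i
  proof -
    have "(\<Sum>j\<in>T. G i j * e b j) = (\<Sum>j\<in>T. \<Sum>b'\<in>B. s b b' * (G i j * f b' j))"
      using that by (simp add: es sum_distrib_left mult.left_commute)
    also have "\<dots> = (\<Sum>b'\<in>B. s b b' * (\<Sum>j\<in>T. G i j * f b' j))"
      by (subst sum.swap) (simp add: sum_distrib_left)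
    finally show ?thesis using that fixG by (simp add: es)
  qed
  have row: "(\<Sum>b\<in>B. (cmod (e b i))\<^sup>2) \<le> (\<Sum>j\<in>T. (cmod (G i j))\<^sup>2)" if i: "i \<in> T" for i
  proof -
    \<comment> \<open>The orthogonal projection of row \<open>i\<close> to the span of the conjugated family.\<close>
    define z where "z j = (\<Sum>b\<in>B. e b i * cnj (e b j))" for j
    define S where "S = (\<Sum>b\<in>B. (cmod (e b i))\<^sup>2)"
    have S: "complex_of_real S = (\<Sum>b\<in>B. e b i * cnj (e b i))"
      by (simp add: S_def complex_norm_square[symmetric])
    have Gz: "(\<Sum>j\<in>T. G i j * cnj (z j)) = complex_of_real S"
    proof -
      have "(\<Sum>j\<in>T. G i j * cnj (z j)) = (\<Sum>j\<in>T. \<Sum>b\<in>B. cnj (e b i) * (G i j * e b j))"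
        by (simp add: z_def sum_distrib_left mult_ac)
      also have "\<dots> = (\<Sum>b\<in>B. cnj (e b i) * (\<Sum>j\<in>T. G i j * e b j))"
        by (subst sum.swap) (simp add: sum_distrib_left)
      also have "\<dots> = complex_of_real S" using fixe i by (simp add: S mult.commute)
      finally show ?thesis .
    qed
    have zz: "(\<Sum>j\<in>T. z j * cnj (z j)) = complex_of_real S"
    proof -
      have "(\<Sum>j\<in>T. z j * cnj (z j)) = (\<Sum>j\<in>T. \<Sum>b\<in>B. \<Sum>b'\<in>B. e b i * cnj (e b' i) * (e b' j * cnj (e b j)))"
        by (simp add: z_def sum_product) (simp add: mult_ac)
      also have "\<dots> = (\<Sum>b\<in>B. \<Sum>j\<in>T. \<Sum>b'\<in>B. e b i * cnj (e b' i) * (e b' j * cnj (e b j)))"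
        by (rule sum.swap)
      also have "\<dots> = (\<Sum>b\<in>B. \<Sum>b'\<in>B. \<Sum>j\<in>T. e b i * cnj (e b' i) * (e b' j * cnj (e b j)))"
        by (intro sum.cong refl sum.swap)
      also have "\<dots> = (\<Sum>b\<in>B. \<Sum>b'\<in>B. e b i * cnj (e b' i) * cinner_on T (e b') (e b))"
        by (simp add: cinner_on_def sum_distrib_left)
      also have "\<dots> = (\<Sum>b\<in>B. \<Sum>b'\<in>B. if b = b' then e b i * cnj (e b' i) else 0)"
        by (intro sum.cong refl) (use on in auto)
      also have "\<dots> = complex_of_real S" using finB by (simp add: S)
      finally show ?thesis .
    qed
    have zG: "(\<Sum>j\<in>T. z j * cnj (G i j)) = complex_of_real S"
    proof -
      have "(\<Sum>j\<in>T. z j * cnj (G i j)) = cnj (\<Sum>j\<in>T. G i j * cnj (z j))"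
        by (simp add: mult.commute)
      then show ?thesis using Gz by simp
    qed
    have "complex_of_real (\<Sum>j\<in>T. (cmod (G i j - z j))\<^sup>2)
        = (\<Sum>j\<in>T. (G i j - z j) * cnj (G i j - z j))"
      by (simp only: of_real_sum complex_norm_square)
    also have "\<dots> = (\<Sum>j\<in>T. G i j * cnj (G i j)) - (\<Sum>j\<in>T. G i j * cnj (z j))
        - (\<Sum>j\<in>T. z j * cnj (G i j)) + (\<Sum>j\<in>T. z j * cnj (z j))"
      by (simp add: algebra_simps sum.distrib sum_subtractf)
    also have "\<dots> = complex_of_real ((\<Sum>j\<in>T. (cmod (G i j))\<^sup>2) - S)"
      by (simp only: Gz zG zz of_real_diff of_real_sum complex_norm_square) simp
    finally have "(\<Sum>j\<in>T. (cmod (G i j - z j))\<^sup>2) = (\<Sum>j\<in>T. (cmod (G i j))\<^sup>2) - S"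
      using of_real_eq_iff by blast
    moreover have "(\<Sum>j\<in>T. (cmod (G i j - z j))\<^sup>2) \<ge> 0" by (simp add: sum_nonneg)
    ultimately show ?thesis by (simp add: S_def)
  qed
  have "complex_of_real (\<Sum>i\<in>T. (cmod (e b i))\<^sup>2) = 1" if "b \<in> B" for b
    using on[OF that that] by (simp only: cinner_on_def of_real_sum complex_norm_square simp_thms if_True)
  then have "(\<Sum>i\<in>T. (cmod (e b i))\<^sup>2) = 1" if "b \<in> B" for b
    using that of_real_eq_1_iff by blast
  then have "real (card B) = (\<Sum>b\<in>B. \<Sum>i\<in>T. (cmod (e b i))\<^sup>2)" by simp
  also have "\<dots> = (\<Sum>i\<in>T. \<Sum>b\<in>B. (cmod (e b i))\<^sup>2)" by (rule sum.swap)
  also have "\<dots> \<le> (\<Sum>i\<in>T. \<Sum>j\<in>T. (cmod (G i j))\<^sup>2)" by (rule sum_mono) (rule row)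
  finally show ?thesis .
qed

section \<open>Rank bounds from weighted triples\<close>

text \<open>
  For the Gram matrix \<open>M\<close> of the rescaled columns, the entry at \<open>i \<noteq> j\<close> is a sum over the rows through
  \<open>i\<close> and \<open>j\<close>. By the Cauchy-Schwarz inequality its square is at most the total weight of these rows times
  \<open>(\<Sum>r. w r * p r i * p r j)\<close>, where \<open>p r\<close> is the probability vector of squared entries of row \<open>r\<close>. The
  hypothesis on pairs cancels the normalisation by \<open>c i * c j\<close>, and summing the products \<open>p r i * p r j\<close>
  over all \<open>i, j\<close> leaves \<open>\<kappa> * (\<Sum>r. w r)\<close>.
\<close>

lemma weighted_design_bound:
  fixes w :: "'r \<Rightarrow> real" and e :: "'r \<Rightarrow> 'a set" and a :: "'r \<Rightarrow> 'a \<Rightarrow> complex"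
    and f :: "'b \<Rightarrow> 'a \<Rightarrow> complex"
  assumes finT: "finite T" and finR: "finite R" and finB: "finite B"
    and e: "\<And>r. r \<in> R \<Longrightarrow> e r \<subseteq> T \<and> card (e r) = q" and q: "q > 0"
    and w: "\<And>r. r \<in> R \<Longrightarrow> w r \<ge> 0"
    and a: "\<And>r i. r \<in> R \<Longrightarrow> i \<in> e r \<Longrightarrow> a r i \<noteq> 0"
    and c: "\<And>i. i \<in> T \<Longrightarrow> c i = (\<Sum>r | r \<in> R \<and> i \<in> e r. w r) / real q"
    and cpos: "\<And>i. i \<in> T \<Longrightarrow> c i > 0"
    and pair: "\<And>i j. i \<in> T \<Longrightarrow> j \<in> T \<Longrightarrow> i \<noteq> j \<Longrightarrow>
      (\<Sum>r | r \<in> R \<and> i \<in> e r \<and> j \<in> e r. w r) \<le> \<kappa> * c i * c j"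
    and kappa: "\<kappa> \<ge> 0"
    and ind: "independent_family T B f"
    and rel: "\<And>b r. b \<in> B \<Longrightarrow> r \<in> R \<Longrightarrow> (\<Sum>i\<in>e r. a r i * f b i) = 0"
  shows "real (card B) \<le> \<kappa> * (\<Sum>r\<in>R. w r)"
proof (rule field_le_epsilon)
  fix \<epsilon> :: real assume eps: "\<epsilon> > 0"
  define Z where "Z = 1 + (\<Sum>i\<in>T. 1 / (c i)\<^sup>2)"
  have Z: "Z > 0" unfolding Z_def by (intro add_pos_nonneg sum_nonneg) auto
  \<comment> \<open>Column errors of this size contribute at most \<open>\<epsilon>\<close> to the diagonal of \<open>G\<close>.\<close>
  define \<epsilon>' where "\<epsilon>' = sqrt (\<epsilon> / Z)"
  have eps': "\<epsilon>' > 0" "\<epsilon>'\<^sup>2 = \<epsilon> / Z" using eps Z by (auto simp: \<epsilon>'_def)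
  have fe: "finite (e r)" if "r \<in> R" for r using e[OF that] finT finite_subset by blast
  obtain x where x: "\<And>i. x i > (0::real)" and
    scaled: "\<And>i. \<bar>\<Sum>r | r \<in> R \<and> i \<in> e r. w r *
      ((cmod (a r i))\<^sup>2 * x i / (\<Sum>j\<in>e r. (cmod (a r j))\<^sup>2 * x j) - 1 / real q)\<bar> \<le> \<epsilon>'"
    using scaling_columns[of R e q w "\<lambda>r i. (cmod (a r i))\<^sup>2" \<epsilon>'] finR e fe q w a eps'(1) by auto
  define S where "S r = (\<Sum>j\<in>e r. (cmod (a r j))\<^sup>2 * x j)" for r
  have S: "S r > 0" if r: "r \<in> R" for r
  proof -
    have "e r \<noteq> {}" using e[OF r] q by auto
    then show ?thesis unfolding S_def using fe[OF r] a[OF r] x by (intro sum_pos) auto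
  qed
  define b where "b r i = (if i \<in> e r then a r i * complex_of_real (sqrt (x i / S r)) else 0)" for r i
  define p where "p r i = (cmod (b r i))\<^sup>2" for r i
  have p_eq: "p r i = (if i \<in> e r then (cmod (a r i))\<^sup>2 * x i / S r else 0)" if "r \<in> R" for r i
    using S[OF that] less_imp_le[OF x[of i]] by (simp add: p_def b_def norm_mult power_mult_distrib)
  have p0: "p r i \<ge> 0" for r i by (simp add: p_def)
  have p_sum: "(\<Sum>i\<in>T. p r i) = 1" if r: "r \<in> R" for r
  proof -
    have "(\<Sum>i\<in>T. p r i) = (\<Sum>i\<in>e r. (cmod (a r i))\<^sup>2 * x i / S r)"
      using e[OF r] finT by (simp add: p_eq[OF r] sum.If_cases Int_absorb1)
    also have "\<dots> = S r / S r" by (simp only: S_def sum_divide_distrib)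
    finally show ?thesis using S[OF r] by simp
  qed
  define g where "g i = (\<Sum>r\<in>R. w r * p r i) - c i" for i
  have g: "\<bar>g i\<bar> \<le> \<epsilon>'" if i: "i \<in> T" for i
  proof -
    have "(\<Sum>r\<in>R. w r * p r i) = (\<Sum>r | r \<in> R \<and> i \<in> e r. w r * ((cmod (a r i))\<^sup>2 * x i / S r))"
      by (subst sum.inter_filter[OF finR]) (auto intro!: sum.cong simp: p_eq)
    then have "g i = (\<Sum>r | r \<in> R \<and> i \<in> e r. w r * ((cmod (a r i))\<^sup>2 * x i / S r - 1 / real q))"
      by (simp add: g_def c[OF i] right_diff_distrib sum_subtractf sum_divide_distrib)
    then show ?thesis using scaled[of i] by (simp add: S_def)
  qed
  \<comment> \<open>Dividing \<open>M\<close> by \<open>sqrt (c i) * sqrt (c j)\<close> brings its diagonal close to 1. A solution \<open>f\<close> has to be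
    rescaled inversely to both this and the column scaling by \<open>sqrt (x i)\<close>.\<close>
  define M where "M i j = (\<Sum>r\<in>R. complex_of_real (w r) * cnj (b r i) * b r j)" for i j
  define G where "G i j = (if i = j then 1 else 0) - M i j / complex_of_real (sqrt (c i) * sqrt (c j))" for i j
  define f' where "f' \<beta> i = f \<beta> i * complex_of_real (sqrt (c i / x i))" for \<beta> i
  have ind': "independent_family T B f'"
    unfolding independent_family_def
  proof (intro allI impI)
    fix t assume t: "\<forall>i\<in>T. (\<Sum>\<beta>\<in>B. t \<beta> * f' \<beta> i) = 0"
    have "(\<Sum>\<beta>\<in>B. t \<beta> * f \<beta> i) = 0" if i: "i \<in> T" for i
    proof -
      have "(\<Sum>\<beta>\<in>B. t \<beta> * f' \<beta> i) = (\<Sum>\<beta>\<in>B. t \<beta> * f \<beta> i) * complex_of_real (sqrt (c i / x i))"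
        by (simp add: f'_def sum_distrib_right mult.assoc)
      moreover have "sqrt (c i / x i) \<noteq> 0" using cpos[OF i] x[of i] by simp
      ultimately show ?thesis using t i by simp
    qed
    then show "\<forall>\<beta>\<in>B. t \<beta> = 0" using ind unfolding independent_family_def by blast
  qed
  have fixG: "(\<Sum>j\<in>T. G i j * f' \<beta> j) = f' \<beta> i" if \<beta>: "\<beta> \<in> B" and i: "i \<in> T" for \<beta> i
  proof -
    have row0: "(\<Sum>j\<in>T. b r j * (f' \<beta> j / complex_of_real (sqrt (c j)))) = 0" if r: "r \<in> R" for r
    proof -
      have "(\<Sum>j\<in>T. b r j * (f' \<beta> j / complex_of_real (sqrt (c j))))
        = (\<Sum>j\<in>e r. b r j * (f' \<beta> j / complex_of_real (sqrt (c j))))"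
        using e[OF r] finT by (intro sum.mono_neutral_right) (auto simp: b_def)
      also have "\<dots> = (\<Sum>j\<in>e r. a r j * f \<beta> j * complex_of_real (1 / sqrt (S r)))"
      proof (intro sum.cong refl)
        fix j assume j: "j \<in> e r"
        have "c j > 0" "x j > 0" "S r > 0" using e[OF r] j cpos x S[OF r] by auto
        then have "sqrt (x j / S r) * (sqrt (c j / x j) / sqrt (c j)) = 1 / sqrt (S r)"
          by (simp add: real_sqrt_divide field_simps)
        then have "complex_of_real (sqrt (x j / S r)) * (complex_of_real (sqrt (c j / x j)) / complex_of_real (sqrt (c j)))
          = complex_of_real (1 / sqrt (S r))"
          by (metis of_real_divide of_real_mult)
        then show "b r j * (f' \<beta> j / complex_of_real (sqrt (c j))) = a r j * f \<beta> j * complex_of_real (1 / sqrt (S r))"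
          using j by (simp add: b_def f'_def mult.assoc mult.left_commute times_divide_eq_right[symmetric]
              del: times_divide_eq_right of_real_divide)
      qed
      also have "\<dots> = (\<Sum>j\<in>e r. a r j * f \<beta> j) * complex_of_real (1 / sqrt (S r))"
        by (simp only: sum_distrib_right)
      finally show ?thesis using rel[OF \<beta> r] by simp
    qed
    have "(\<Sum>j\<in>T. M i j / complex_of_real (sqrt (c i) * sqrt (c j)) * f' \<beta> j)
      = (\<Sum>j\<in>T. \<Sum>r\<in>R. complex_of_real (w r) * cnj (b r i) / complex_of_real (sqrt (c i)) * (b r j * (f' \<beta> j / complex_of_real (sqrt (c j)))))"
      by (simp add: M_def sum_distrib_right sum_divide_distrib mult.assoc)
    also have "\<dots> = (\<Sum>r\<in>R. complex_of_real (w r) * cnj (b r i) / complex_of_real (sqrt (c i)) * (\<Sum>j\<in>T. b r j * (f' \<beta> j / complex_of_real (sqrt (c j)))))"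
      by (subst sum.swap) (simp only: sum_distrib_left)
    also have "\<dots> = 0" by (intro sum.neutral ballI) (simp only: row0 mult_zero_right)
    finally have "(\<Sum>j\<in>T. M i j / complex_of_real (sqrt (c i) * sqrt (c j)) * f' \<beta> j) = 0" .
    moreover have "(\<Sum>j\<in>T. (if i = j then 1 else 0) * f' \<beta> j) = f' \<beta> i"
    proof -
      have "(\<Sum>j\<in>T. (if i = j then 1 else 0) * f' \<beta> j) = (\<Sum>j\<in>T. if i = j then f' \<beta> j else 0)"
        by (intro sum.cong) auto
      then show ?thesis using i finT by simp
    qed
    ultimately show ?thesis by (simp add: G_def left_diff_distrib sum_subtractf)
  qed
  define Q where "Q i j = (\<Sum>r\<in>R. w r * (p r i * p r j))" for i j
  have Q0: "Q i j \<ge> 0" for i j unfolding Q_def by (intro sum_nonneg mult_nonneg_nonneg w p0)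
  have off: "(cmod (G i j))\<^sup>2 \<le> \<kappa> * Q i j" if i: "i \<in> T" and j: "j \<in> T" and ij: "i \<noteq> j" for i j
  proof -
    define Rij where "Rij = {r. r \<in> R \<and> i \<in> e r \<and> j \<in> e r}"
    have subR: "Rij \<subseteq> R" "finite Rij" using finR by (auto simp: Rij_def)
    have "cmod (M i j) \<le> (\<Sum>r\<in>R. cmod (complex_of_real (w r) * cnj (b r i) * b r j))"
      unfolding M_def by (rule norm_sum)
    also have "\<dots> = (\<Sum>r\<in>R. w r * (cmod (b r i) * cmod (b r j)))"
      using w by (intro sum.cong) (auto simp: norm_mult)
    also have "\<dots> = (\<Sum>r\<in>Rij. w r * (cmod (b r i) * cmod (b r j)))"
      using finR by (intro sum.mono_neutral_right) (auto simp: Rij_def b_def)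
    also have "\<dots> = (\<Sum>r\<in>Rij. sqrt (w r) * (sqrt (w r) * (cmod (b r i) * cmod (b r j))))"
      using w subR by (intro sum.cong) (auto simp: mult.assoc[symmetric])
    finally have "(cmod (M i j))\<^sup>2 \<le> (\<Sum>r\<in>Rij. sqrt (w r) * (sqrt (w r) * (cmod (b r i) * cmod (b r j))))\<^sup>2"
      by (intro power_mono) auto
    also have "\<dots> \<le> (\<Sum>r\<in>Rij. (sqrt (w r))\<^sup>2) * (\<Sum>r\<in>Rij. (sqrt (w r) * (cmod (b r i) * cmod (b r j)))\<^sup>2)"
      by (rule Cauchy_Schwarz_ineq_sum)
    also have "\<dots> = (\<Sum>r\<in>Rij. w r) * (\<Sum>r\<in>Rij. w r * (p r i * p r j))"
      using w subR by (intro arg_cong2[of _ _ _ _ "(*)"] sum.cong) (auto simp: power_mult_distrib p_def)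
    also have "\<dots> \<le> (\<kappa> * c i * c j) * Q i j"
    proof (intro mult_mono)
      show "(\<Sum>r\<in>Rij. w r) \<le> \<kappa> * c i * c j" using pair[OF i j ij] by (simp add: Rij_def)
      show "(\<Sum>r\<in>Rij. w r * (p r i * p r j)) \<le> Q i j"
        unfolding Q_def using finR subR w p0 by (intro sum_mono2) auto
      show "0 \<le> \<kappa> * c i * c j" using kappa cpos[OF i] cpos[OF j] by simp
      show "0 \<le> (\<Sum>r\<in>Rij. w r * (p r i * p r j))"
        using subR w p0 by (intro sum_nonneg mult_nonneg_nonneg) auto
    qed
    finally have M: "(cmod (M i j))\<^sup>2 \<le> (\<kappa> * c i * c j) * Q i j" .
    have "(cmod (G i j))\<^sup>2 = (cmod (M i j))\<^sup>2 / (c i * c j)"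
      using ij cpos[OF i] cpos[OF j] by (simp add: G_def norm_divide norm_mult power_divide power_mult_distrib)
    also have "\<dots> \<le> \<kappa> * Q i j"
      using M cpos[OF i] cpos[OF j] by (simp add: divide_simps mult_ac)
    finally show ?thesis .
  qed
  have diag: "(cmod (G i i))\<^sup>2 \<le> \<epsilon>'\<^sup>2 * (1 / (c i)\<^sup>2)" if i: "i \<in> T" for i
  proof -
    have "M i i = complex_of_real (c i + g i)"
    proof -
      have "M i i = (\<Sum>r\<in>R. complex_of_real (w r * p r i))"
        unfolding M_def p_def
        by (intro sum.cong refl) (simp only: of_real_mult complex_norm_square mult_ac)
      then show ?thesis by (simp add: g_def)
    qed
    then have "G i i = complex_of_real (1 - (c i + g i) / c i)"
      using cpos[OF i] by (simp add: G_def real_sqrt_mult_self flip: of_real_mult)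
    also have "1 - (c i + g i) / c i = - (g i / c i)" using cpos[OF i] by (simp add: field_simps)
    finally have "(cmod (G i i))\<^sup>2 = (g i)\<^sup>2 / (c i)\<^sup>2"
      by (simp only: norm_of_real) (simp add: power_divide)
    also have "(g i)\<^sup>2 \<le> \<epsilon>'\<^sup>2" using g[OF i] by (simp add: abs_le_square_iff[symmetric])
    finally show ?thesis by (simp add: divide_right_mono)
  qed
  have "real (card B) \<le> (\<Sum>i\<in>T. \<Sum>j\<in>T. (cmod (G i j))\<^sup>2)"
    by (rule card_fixed_family_le[OF finT finB ind' fixG])
  also have "\<dots> \<le> (\<Sum>i\<in>T. \<Sum>j\<in>T. (if i = j then \<epsilon>'\<^sup>2 * (1 / (c i)\<^sup>2) else 0) + \<kappa> * Q i j)"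
  proof (intro sum_mono)
    fix i j assume ij: "i \<in> T" "j \<in> T"
    show "(cmod (G i j))\<^sup>2 \<le> (if i = j then \<epsilon>'\<^sup>2 * (1 / (c i)\<^sup>2) else 0) + \<kappa> * Q i j"
    proof (cases "i = j")
      case True
      then show ?thesis using diag[OF ij(1)] mult_nonneg_nonneg[OF kappa Q0[of i j]] by simp
    next
      case False
      then show ?thesis using off[OF ij] by simp
    qed
  qed
  also have "\<dots> = \<epsilon>'\<^sup>2 * (\<Sum>i\<in>T. 1 / (c i)\<^sup>2) + \<kappa> * (\<Sum>i\<in>T. \<Sum>j\<in>T. Q i j)"
    using finT by (simp add: sum.distrib sum_distrib_left)
  also have "(\<Sum>i\<in>T. \<Sum>j\<in>T. Q i j) = (\<Sum>r\<in>R. w r)"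
  proof -
    have "(\<Sum>i\<in>T. \<Sum>j\<in>T. Q i j) = (\<Sum>r\<in>R. \<Sum>i\<in>T. \<Sum>j\<in>T. w r * (p r i * p r j))"
      unfolding Q_def by (subst sum.swap[of _ R]) (subst sum.swap[of _ R T], rule refl)
    also have "\<dots> = (\<Sum>r\<in>R. w r * ((\<Sum>i\<in>T. p r i) * (\<Sum>j\<in>T. p r j)))"
      by (simp only: sum_product) (simp only: sum_distrib_left)
    finally show ?thesis by (simp add: p_sum)
  qed
  also have "\<epsilon>'\<^sup>2 * (\<Sum>i\<in>T. 1 / (c i)\<^sup>2) \<le> \<epsilon>"
  proof -
    have "\<epsilon>'\<^sup>2 * (\<Sum>i\<in>T. 1 / (c i)\<^sup>2) \<le> \<epsilon>'\<^sup>2 * Z" by (intro mult_left_mono) (auto simp: Z_def)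
    then show ?thesis using eps' Z by simp
  qed
  finally show "real (card B) \<le> \<kappa> * (\<Sum>r\<in>R. w r) + \<epsilon>" by simp
qed

text \<open>
  Lines are given by a function on pairs, and two distinct points of a line determine it. The weight of a
  triple is the product of its masses divided by the mass of its line. Summing over the third point
  shows that the rows through \<open>i, j\<close> have total weight exactly
  \<open>\<mu> i * \<mu> j * (1 - (\<mu> i + \<mu> j) / \<mu>(l i j))\<close>. This is at most \<open>\<mu> i * \<mu> j\<close>, and its sum over \<open>j\<close>, which
  is twice the degree of \<open>i\<close>, is at least \<open>\<mu> i * \<eta>\<close> by the assumption \<open>rich\<close>.
\<close>

lemma linear_space_rank_bound:
  fixes l :: "'a \<Rightarrow> 'a \<Rightarrow> 'a set" and \<mu> :: "'a \<Rightarrow> real" and f :: "'b \<Rightarrow> 'a \<Rightarrow> complex"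
  assumes finT: "finite T" and finB: "finite B"
    and line: "\<And>i j. i \<in> T \<Longrightarrow> j \<in> T \<Longrightarrow> i \<noteq> j \<Longrightarrow> i \<in> l i j \<and> j \<in> l i j \<and> l i j \<subseteq> T"
    and unique: "\<And>i j k m. i \<in> T \<Longrightarrow> j \<in> T \<Longrightarrow> i \<noteq> j \<Longrightarrow> k \<in> l i j \<Longrightarrow> m \<in> l i j \<Longrightarrow> k \<noteq> m \<Longrightarrow>
      l k m = l i j"
    and mu: "\<And>i. i \<in> T \<Longrightarrow> \<mu> i > 0"
    and rel: "\<And>i j r. i \<in> T \<Longrightarrow> j \<in> T \<Longrightarrow> i \<noteq> j \<Longrightarrow> r \<subseteq> l i j \<Longrightarrow> card r = 3 \<Longrightarrow>
      \<exists>a. (\<forall>k\<in>r. a k \<noteq> 0) \<and> (\<forall>b\<in>B. (\<Sum>k\<in>r. a k * f b k) = 0)"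
    and ind: "independent_family T B f"
    and eta: "\<eta> > 0"
    and rich: "\<And>i. i \<in> T \<Longrightarrow> \<eta> \<le> (\<Sum>j\<in>T - {i}. \<mu> j * (1 - (\<mu> i + \<mu> j) / sum \<mu> (l i j)))"
  shows "real (card B) \<le> 6 * (sum \<mu> T)\<^sup>2 / \<eta>\<^sup>2"
proof -
  define L where "L = (\<lambda>(i, j). l i j) ` {(i, j) \<in> T \<times> T. i \<noteq> j}"
  \<comment> \<open>A row is a triple together with its line, which fixes the denominator of its weight.\<close>
  define R where "R = (SIGMA \<ll>:L. {r. r \<subseteq> \<ll> \<and> card r = 3})"
  define w where "w = (\<lambda>(\<ll>, r). prod \<mu> r / sum \<mu> \<ll>)"
  define W where "W i j = (\<Sum>r | r \<in> R \<and> i \<in> snd r \<and> j \<in> snd r. w r)" for i j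
  define c where "c i = (\<Sum>r | r \<in> R \<and> i \<in> snd r. w r) / real 3" for i
  have finL: "finite L" unfolding L_def
    by (intro finite_imageI finite_subset[OF _ finite_cartesian_product[OF finT finT]]) auto
  have L_E: "\<exists>i j. i \<in> T \<and> j \<in> T \<and> i \<noteq> j \<and> \<ll> = l i j" if "\<ll> \<in> L" for \<ll>
    using that by (auto simp: L_def)
  have LT: "\<ll> \<subseteq> T" if "\<ll> \<in> L" for \<ll> using L_E[OF that] line by metis
  have L_eq: "\<ll> = l i j" if "\<ll> \<in> L" "i \<in> \<ll>" "j \<in> \<ll>" "i \<noteq> j" for \<ll> i j
    using L_E[OF that(1)] unique that by metis
  have l_L: "l i j \<in> L" if "i \<in> T" "j \<in> T" "i \<noteq> j" for i j
    using that by (auto simp: L_def)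
  have finR: "finite R" unfolding R_def
  proof (rule finite_SigmaI[OF finL])
    fix \<ll> assume "\<ll> \<in> L"
    then have "{r. r \<subseteq> \<ll> \<and> card r = 3} \<subseteq> Pow T" using LT by blast
    then show "finite {r. r \<subseteq> \<ll> \<and> card r = 3}" using finT finite_subset by blast
  qed
  have R_T: "snd r \<subseteq> T \<and> card (snd r) = 3" if "r \<in> R" for r
    using that LT[of "fst r"] by (auto simp: R_def) blast
  have mpos: "sum \<mu> (l i j) \<ge> \<mu> i + \<mu> j" "sum \<mu> (l i j) > 0"
    if ij: "i \<in> T" "j \<in> T" "i \<noteq> j" for i j
  proof -
    have "sum \<mu> {i, j} \<le> sum \<mu> (l i j)"
      using line[OF ij] finT mu by (intro sum_mono2) (auto intro: finite_subset less_imp_le)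
    then show "sum \<mu> (l i j) \<ge> \<mu> i + \<mu> j" using ij by simp
    then show "sum \<mu> (l i j) > 0" using mu[OF ij(1)] mu[OF ij(2)] by linarith
  qed
  have w0: "w r \<ge> 0" if "r \<in> R" for r
  proof -
    have "prod \<mu> (snd r) \<ge> 0" using R_T[OF that] mu by (intro prod_nonneg) (auto intro: less_imp_le)
    moreover have "fst r \<in> L" using that by (auto simp: R_def)
    then have "fst r \<subseteq> T" by (rule LT)
    then have "sum \<mu> (fst r) \<ge> 0" by (intro sum_nonneg less_imp_le mu) blast
    ultimately show ?thesis by (simp add: w_def split_beta)
  qed
  have W_eq: "W i j = \<mu> i * (\<mu> j * (1 - (\<mu> i + \<mu> j) / sum \<mu> (l i j)))"
    if ij: "i \<in> T" "j \<in> T" "i \<noteq> j" for i j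
  proof -
    let ?l = "l i j"
    have fl: "finite ?l" using line[OF ij] finT finite_subset by blast
    have "{r. r \<in> R \<and> i \<in> snd r \<and> j \<in> snd r} = (\<lambda>k. (?l, {i, j, k})) ` (?l - {i, j})"
    proof (intro equalityI subsetI)
      fix r assume "r \<in> {r. r \<in> R \<and> i \<in> snd r \<and> j \<in> snd r}"
      then obtain \<ll> s where r: "r = (\<ll>, s)" "\<ll> \<in> L" "s \<subseteq> \<ll>" "card s = 3" "i \<in> s" "j \<in> s"
        by (auto simp: R_def)
      have "\<ll> = ?l" using r ij by (intro L_eq) auto
      have "finite s" using r(4) card.infinite by fastforce
      then have "card (s - {i, j}) = 1" using r ij by (simp add: card_Diff_subset)
      then obtain k where "s - {i, j} = {k}" using card_1_singletonE by blast
      then have "s = {i, j, k}" "k \<in> ?l - {i, j}" using r \<open>\<ll> = ?l\<close> by auto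
      then show "r \<in> (\<lambda>k. (?l, {i, j, k})) ` (?l - {i, j})" using r(1) \<open>\<ll> = ?l\<close> by auto
    next
      fix r assume "r \<in> (\<lambda>k. (?l, {i, j, k})) ` (?l - {i, j})"
      then show "r \<in> {r. r \<in> R \<and> i \<in> snd r \<and> j \<in> snd r}"
        using line[OF ij] l_L[OF ij] ij by (auto simp: R_def card_insert_if)
    qed
    moreover have "inj_on (\<lambda>k. (?l, {i, j, k})) (?l - {i, j})"
    proof (rule inj_onI)
      fix k k' assume "k \<in> ?l - {i, j}" "k' \<in> ?l - {i, j}" "(?l, {i, j, k}) = (?l, {i, j, k'})"
      then have "k \<in> {i, j, k'}" "k \<notin> {i, j}" by auto
      then show "k = k'" by simp
    qed
    ultimately have "W i j = (\<Sum>k\<in>?l - {i, j}. w (?l, {i, j, k}))"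
      by (simp add: W_def sum.reindex)
    also have "\<dots> = (\<Sum>k\<in>?l - {i, j}. \<mu> i * \<mu> j / sum \<mu> ?l * \<mu> k)"
      using ij by (intro sum.cong) (auto simp: w_def)
    also have "\<dots> = \<mu> i * \<mu> j / sum \<mu> ?l * (sum \<mu> ?l - sum \<mu> {i, j})"
      using line[OF ij] fl by (simp only: sum_distrib_left[symmetric]) (simp add: sum_diff)
    also have "\<dots> = \<mu> i * (\<mu> j * (1 - (\<mu> i + \<mu> j) / sum \<mu> ?l))"
      using mpos[OF ij] ij by (simp add: field_simps)
    finally show ?thesis .
  qed
  have W_le: "W i j \<le> \<mu> i * \<mu> j" if ij: "i \<in> T" "j \<in> T" "i \<noteq> j" for i j
  proof -
    have "1 - (\<mu> i + \<mu> j) / sum \<mu> (l i j) \<le> 1"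
      using mpos[OF ij] mu[OF ij(1)] mu[OF ij(2)] by simp
    then have "\<mu> j * (1 - (\<mu> i + \<mu> j) / sum \<mu> (l i j)) \<le> \<mu> j"
      using mu[OF ij(2)] by (simp add: mult_left_le)
    then show ?thesis unfolding W_eq[OF ij] using mu[OF ij(1)] by simp
  qed
  \<comment> \<open>Each row through \<open>i\<close> is counted once for each of its two other points.\<close>
  have deg: "(\<Sum>j\<in>T - {i}. W i j) = 2 * (3 * c i)" if i: "i \<in> T" for i
  proof -
    have "(\<Sum>j\<in>T - {i}. W i j) = (\<Sum>j\<in>T - {i}. \<Sum>r\<in>{r \<in> {r \<in> R. i \<in> snd r}. j \<in> snd r}. w r)"
      unfolding W_def by (intro sum.cong) auto
    also have "\<dots> = (\<Sum>r | r \<in> R \<and> i \<in> snd r. \<Sum>j\<in>{j \<in> T - {i}. j \<in> snd r}. w r)"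
      using finT finR by (intro sum.swap_restrict) auto
    also have "\<dots> = (\<Sum>r | r \<in> R \<and> i \<in> snd r. 2 * w r)"
    proof (intro sum.cong refl)
      fix r assume r: "r \<in> {r. r \<in> R \<and> i \<in> snd r}"
      then have "{j \<in> T - {i}. j \<in> snd r} = snd r - {i}" using R_T[of r] by auto
      moreover have "card (snd r - {i}) = 2" using r R_T[of r] by simp
      ultimately show "(\<Sum>j\<in>{j \<in> T - {i}. j \<in> snd r}. w r) = 2 * w r" by simp
    qed
    also have "\<dots> = 2 * (3 * c i)" by (simp only: sum_distrib_left[symmetric]) (simp add: c_def)
    finally show ?thesis .
  qed
  have c_ge: "c i \<ge> \<mu> i * \<eta> / 6" if i: "i \<in> T" for i
  proof -
    have W_sum: "(\<Sum>j\<in>T - {i}. W i j) = \<mu> i * (\<Sum>j\<in>T - {i}. \<mu> j * (1 - (\<mu> i + \<mu> j) / sum \<mu> (l i j)))"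
      unfolding sum_distrib_left using i by (intro sum.cong W_eq) auto
    have "\<mu> i * \<eta> \<le> (\<Sum>j\<in>T - {i}. W i j)"
      unfolding W_sum by (rule mult_left_mono[OF rich[OF i] less_imp_le[OF mu[OF i]]])
    then show ?thesis unfolding deg[OF i] by simp
  qed
  have cpos: "c i > 0" if i: "i \<in> T" for i
    using c_ge[OF i] mu[OF i] eta by (meson divide_pos_pos less_le_trans mult_pos_pos zero_less_numeral)
  have "(\<Sum>i\<in>T. 3 * c i) = (\<Sum>i\<in>T. \<Sum>r\<in>{r \<in> R. i \<in> snd r}. w r)"
    by (simp add: c_def)
  also have "\<dots> = (\<Sum>r\<in>R. \<Sum>i\<in>{i \<in> T. i \<in> snd r}. w r)"
    using finT finR by (rule sum.swap_restrict)
  also have "\<dots> = (\<Sum>r\<in>R. 3 * w r)"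
  proof (intro sum.cong refl)
    fix r assume r: "r \<in> R"
    then have "{i \<in> T. i \<in> snd r} = snd r" using R_T[of r] by auto
    then show "(\<Sum>i\<in>{i \<in> T. i \<in> snd r}. w r) = 3 * w r" using R_T[OF r] by simp
  qed
  finally have "(\<Sum>r\<in>R. w r) = (\<Sum>i\<in>T. c i)" by (simp add: sum_distrib_left[symmetric])
  also have "\<dots> \<le> (\<Sum>i\<in>T. \<mu> i * sum \<mu> T / 6)"
  proof (intro sum_mono)
    fix i assume i: "i \<in> T"
    have "(\<Sum>j\<in>T - {i}. W i j) \<le> (\<Sum>j\<in>T - {i}. \<mu> i * \<mu> j)"
      using i by (intro sum_mono W_le) auto
    also have "\<dots> \<le> (\<Sum>j\<in>T. \<mu> i * \<mu> j)"
      using finT mu i by (intro sum_mono2) (auto intro: less_imp_le)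
    also have "\<dots> = \<mu> i * sum \<mu> T" by (simp add: sum_distrib_left)
    finally show "c i \<le> \<mu> i * sum \<mu> T / 6" using deg[OF i] by simp
  qed
  also have "\<dots> = (sum \<mu> T)\<^sup>2 / 6"
    by (simp add: power2_eq_square sum_distrib_right sum_divide_distrib)
  finally have total: "(\<Sum>r\<in>R. w r) \<le> (sum \<mu> T)\<^sup>2 / 6" .
  have "\<exists>a. \<forall>r\<in>R. (\<forall>k\<in>snd r. a r k \<noteq> 0) \<and> (\<forall>b\<in>B. (\<Sum>k\<in>snd r. a r k * f b k) = 0)"
  proof (rule bchoice, rule ballI)
    fix r assume "r \<in> R"
    then obtain i j where "i \<in> T" "j \<in> T" "i \<noteq> j" "snd r \<subseteq> l i j" "card (snd r) = 3"
      by (auto simp: R_def L_def)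
    then show "\<exists>a. (\<forall>k\<in>snd r. a k \<noteq> 0) \<and> (\<forall>b\<in>B. (\<Sum>k\<in>snd r. a k * f b k) = 0)"
      by (rule rel)
  qed
  then obtain a where a: "\<And>r k. r \<in> R \<Longrightarrow> k \<in> snd r \<Longrightarrow> a r k \<noteq> 0"
    and a_rel: "\<And>b r. b \<in> B \<Longrightarrow> r \<in> R \<Longrightarrow> (\<Sum>k\<in>snd r. a r k * f b k) = 0" by blast
  have "real (card B) \<le> (36 / \<eta>\<^sup>2) * (\<Sum>r\<in>R. w r)"
  proof (rule weighted_design_bound[OF finT finR finB R_T _ w0 a _ cpos _ _ ind a_rel])
    show "(0 :: nat) < 3" by simp
    show "c i = (\<Sum>r | r \<in> R \<and> i \<in> snd r. w r) / real 3" for i by (simp add: c_def)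
    show "0 \<le> 36 / \<eta>\<^sup>2" by simp
    fix i j assume ij: "i \<in> T" "j \<in> T" "i \<noteq> j"
    have "(\<mu> i * \<eta> / 6) * (\<mu> j * \<eta> / 6) \<le> c i * c j"
      using c_ge ij cpos[OF ij(1)] mu eta by (intro mult_mono) (auto intro: less_imp_le)
    then have "\<mu> i * \<mu> j \<le> 36 / \<eta>\<^sup>2 * c i * c j"
      using eta by (simp add: field_simps power2_eq_square)
    then show "(\<Sum>r | r \<in> R \<and> i \<in> snd r \<and> j \<in> snd r. w r) \<le> 36 / \<eta>\<^sup>2 * c i * c j"
      using W_le[OF ij] by (simp add: W_def)
  qed
  also have "\<dots> \<le> (36 / \<eta>\<^sup>2) * ((sum \<mu> T)\<^sup>2 / 6)"
    using total by (intro mult_left_mono) auto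
  finally show ?thesis by simp
qed

section \<open>Coordinates and collinear points\<close>

text \<open>
  The functions \<open>f b\<close> are the coordinates with respect to a basis \<open>B \<subseteq> T\<close> of the span. They satisfy
  every linear relation between points of \<open>T\<close> because the basis is independent, and they are independent
  because \<open>f b\<close> is 1 at \<open>b\<close> and 0 at the other points of \<open>B\<close>.
\<close>

lemma span_dim_coordinates:
  fixes T :: "complex vec set"
  assumes T: "T \<subseteq> carrier_vec n" and finT: "finite T"
  shows "\<exists>(B :: complex vec set) f. finite B \<and> card B = vec_space.span_dim n T \<and> independent_family T B f \<and>
    (\<forall>r a. r \<subseteq> T \<longrightarrow> (\<forall>k<n. (\<Sum>p\<in>r. a p * p $ k) = 0) \<longrightarrow> (\<forall>b\<in>B. (\<Sum>p\<in>r. a p * f b p) = 0))"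
proof -
  interpret vec_space "TYPE(complex)" n .
  have "\<exists>B. finite B \<and> maximal B (\<lambda>S. S \<subseteq> T \<and> lin_indpt S) \<and> {} \<subseteq> B"
    by (rule maximal_exists_superset[of T]) (auto simp: finT lin_dep_def)
  then obtain B where finB: "finite B" and max: "maximal B (\<lambda>S. S \<subseteq> T \<and> lin_indpt S)" by blast
  have BT: "B \<subseteq> T" and indB: "lin_indpt B" using max by (auto simp: maximal_def)
  have Bc: "B \<subseteq> carrier_vec n" using BT T by auto
  have dim: "span_dim T = card B" unfolding span_dim_def by (rule dim_span[OF T finT max])
  have zero_coeffs: "\<forall>b\<in>B. t b = 0" if "\<And>k. k < n \<Longrightarrow> (\<Sum>b\<in>B. t b * b $ k) = 0" for t :: "complex vec \<Rightarrow> complex"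
  proof -
    have "lincomb t B = 0\<^sub>v n"
      using that by (intro eq_vecI) (auto simp: lincomb_index[OF _ Bc] lincomb_dim[OF finB Bc])
    then have "lin_dep B" if "v \<in> B" "t v \<noteq> 0" for v
      unfolding lin_dep_def using finB that
      by (intro exI[of _ B] exI[of _ t] exI[of _ v]) simp
    then show ?thesis using indB by blast
  qed
  have "\<exists>t. \<forall>k<n. p $ k = (\<Sum>b\<in>B. t b * b $ k)" if p: "p \<in> T" for p
  proof -
    have "p \<in> span B"
    proof (cases "p \<in> B")
      case True
      then show ?thesis using in_own_span Bc by auto
    next
      case False
      have "\<not> lin_indpt (B \<union> {p})" using max False p BT unfolding maximal_def by blast
      moreover have "p \<in> carrier_vec n" using p T by blast
      ultimately show ?thesis using lin_dep_iff_in_span[of B p] Bc indB False by simp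
    qed
    then obtain t where t: "lincomb t B = p" using finite_in_span[OF finB] Bc by auto
    have "\<forall>k<n. p $ k = (\<Sum>b\<in>B. t b * b $ k)"
      using lincomb_index[OF _ Bc, of _ t] unfolding t by simp
    then show ?thesis by blast
  qed
  then have "\<exists>t. \<forall>p\<in>T. \<forall>k<n. p $ k = (\<Sum>b\<in>B. t p b * b $ k)" by (intro bchoice ballI)
  then obtain t where t: "\<And>p k. p \<in> T \<Longrightarrow> k < n \<Longrightarrow> p $ k = (\<Sum>b\<in>B. t p b * b $ k)" by blast
  define f where "f b p = t p b" for b p
  have rel: "(\<Sum>p\<in>r. a p * f b p) = 0"
    if r: "r \<subseteq> T" and z: "\<And>k. k < n \<Longrightarrow> (\<Sum>p\<in>r. a p * p $ k) = 0" and b: "b \<in> B" for r a b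
  proof -
    have "\<forall>b\<in>B. (\<Sum>p\<in>r. a p * f b p) = 0"
    proof (rule zero_coeffs)
      fix k assume k: "k < n"
      have "(\<Sum>b\<in>B. (\<Sum>p\<in>r. a p * f b p) * b $ k) = (\<Sum>p\<in>r. a p * (\<Sum>b\<in>B. t p b * b $ k))"
        unfolding sum_distrib_right sum_distrib_left
        by (subst sum.swap) (simp add: f_def mult.assoc)
      also have "\<dots> = (\<Sum>p\<in>r. a p * p $ k)" using r t k by (intro sum.cong) auto
      finally show "(\<Sum>b\<in>B. (\<Sum>p\<in>r. a p * f b p) * b $ k) = 0" using z[OF k] by simp
    qed
    then show ?thesis using b by blast
  qed
  have unit: "t p b = (if p = b then 1 else 0)" if p: "p \<in> B" and b: "b \<in> B" for p b
  proof -
    have "\<forall>b\<in>B. t p b - (if p = b then 1 else 0) = 0"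
    proof (rule zero_coeffs)
      fix k assume k: "k < n"
      have "(\<Sum>b\<in>B. (if p = b then 1 else 0) * b $ k) = (\<Sum>b\<in>B. if p = b then b $ k else 0)"
        by (intro sum.cong) auto
      also have "\<dots> = p $ k" using p finB by simp
      finally show "(\<Sum>b\<in>B. (t p b - (if p = b then 1 else 0)) * b $ k) = 0"
        using t[OF _ k, of p] p BT by (simp add: left_diff_distrib sum_subtractf subset_iff)
    qed
    then show ?thesis using b by simp
  qed
  have ind: "independent_family T B f"
    unfolding independent_family_def
  proof (intro allI impI ballI)
    fix s b assume s: "\<forall>p\<in>T. (\<Sum>b\<in>B. s b * f b p) = 0" and b: "b \<in> B"
    have "(\<Sum>b'\<in>B. s b' * f b' b) = (\<Sum>b'\<in>B. if b = b' then s b' else 0)"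
      using unit b by (intro sum.cong) (auto simp: f_def)
    then show "s b = 0" using s b BT finB by auto
  qed
  show ?thesis
    by (intro exI[of _ B] exI[of _ f] conjI finB dim[symmetric] ind) (use rel in blast)
qed

lemma line_through_iff:
  assumes "p \<in> carrier_vec n" "q \<in> carrier_vec n"
  shows "r \<in> line_through p q \<longleftrightarrow> r \<in> carrier_vec n \<and> (\<exists>c. \<forall>k<n. r $ k = p $ k + c * (q $ k - p $ k))"
proof
  assume "r \<in> line_through p q"
  then show "r \<in> carrier_vec n \<and> (\<exists>c. \<forall>k<n. r $ k = p $ k + c * (q $ k - p $ k))"
    using assms by (auto simp: line_through_def)
next
  assume "r \<in> carrier_vec n \<and> (\<exists>c. \<forall>k<n. r $ k = p $ k + c * (q $ k - p $ k))"
  then obtain c where r: "r \<in> carrier_vec n" "\<And>k. k < n \<Longrightarrow> r $ k = p $ k + c * (q $ k - p $ k)" by blast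
  have "r = p + c \<cdot>\<^sub>v (q - p)" using assms r by (intro eq_vecI) auto
  then show "r \<in> line_through p q" by (auto simp: line_through_def)
qed

lemma line_through_eq:
  assumes pq: "p \<in> carrier_vec n" "q \<in> carrier_vec n"
    and x: "x \<in> line_through p q" and y: "y \<in> line_through p q" and "x \<noteq> y"
  shows "line_through x y = line_through p q"
proof -
  obtain s where xs: "x \<in> carrier_vec n" "\<And>k. k < n \<Longrightarrow> x $ k = p $ k + s * (q $ k - p $ k)"
    using x line_through_iff[OF pq] by blast
  obtain t where yt: "y \<in> carrier_vec n" "\<And>k. k < n \<Longrightarrow> y $ k = p $ k + t * (q $ k - p $ k)"
    using y line_through_iff[OF pq] by blast
  have st: "s \<noteq> t"
  proof
    assume "s = t"
    then have "x = y" using xs yt by (intro eq_vecI) auto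
    then show False using \<open>x \<noteq> y\<close> by simp
  qed
  have "(\<exists>c. \<forall>k<n. z $ k = x $ k + c * (y $ k - x $ k)) \<longleftrightarrow> (\<exists>c. \<forall>k<n. z $ k = p $ k + c * (q $ k - p $ k))" for z
  proof
    assume "\<exists>c. \<forall>k<n. z $ k = x $ k + c * (y $ k - x $ k)"
    then obtain c where c: "\<And>k. k < n \<Longrightarrow> z $ k = x $ k + c * (y $ k - x $ k)" by blast
    have "\<forall>k<n. z $ k = p $ k + (s + c * (t - s)) * (q $ k - p $ k)"
      by (auto simp: c xs yt algebra_simps)
    then show "\<exists>c. \<forall>k<n. z $ k = p $ k + c * (q $ k - p $ k)" by blast
  next
    assume "\<exists>c. \<forall>k<n. z $ k = p $ k + c * (q $ k - p $ k)"
    then obtain u where u: "\<And>k. k < n \<Longrightarrow> z $ k = p $ k + u * (q $ k - p $ k)" by blast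
    define c where "c = (u - s) / (t - s)"
    have "u = s + c * (t - s)" using st by (simp add: c_def)
    then have "z $ k = p $ k + (s + c * (t - s)) * (q $ k - p $ k)" if "k < n" for k
      using u[OF that] by simp
    then have "\<forall>k<n. z $ k = x $ k + c * (y $ k - x $ k)"
      by (auto simp: xs yt algebra_simps)
    then show "\<exists>c. \<forall>k<n. z $ k = x $ k + c * (y $ k - x $ k)" by blast
  qed
  then have "z \<in> line_through x y \<longleftrightarrow> z \<in> line_through p q" for z
    unfolding line_through_iff[OF pq] line_through_iff[OF xs(1) yt(1)] by (rule conj_cong[OF refl])
  then show ?thesis by (simp add: set_eq_iff)
qed

lemma endpoints_in_line_through:
  assumes "p \<in> carrier_vec n" "q \<in> carrier_vec n"
  shows "p \<in> line_through p q" "q \<in> line_through p q"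
proof -
  have "\<exists>c. \<forall>k<n. p $ k = p $ k + c * (q $ k - p $ k)" by (rule exI[of _ 0]) simp
  then show "p \<in> line_through p q" using assms line_through_iff by blast
  have "\<exists>c. \<forall>k<n. q $ k = p $ k + c * (q $ k - p $ k)" by (rule exI[of _ 1]) simp
  then show "q \<in> line_through p q" using assms line_through_iff by blast
qed

text \<open>
  Points with parameters \<open>t1, t2, t3\<close> on a line satisfy the relation with coefficients \<open>t2 - t3\<close>, \<open>t3 - t1\<close>,
  \<open>t1 - t2\<close>, and distinct points have distinct parameters.
\<close>

lemma collinear_triple_dependency:
  assumes pq: "p \<in> carrier_vec n" "q \<in> carrier_vec n"
    and r: "r \<subseteq> line_through p q" "card r = 3"
  shows "\<exists>a. (\<forall>x\<in>r. a x \<noteq> 0) \<and> (\<forall>k<n. (\<Sum>x\<in>r. a x * x $ k) = 0)"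
proof -
  obtain x y z where xyz: "r = {x, y, z}" "x \<noteq> y" "y \<noteq> z" "x \<noteq> z" using r(2) by (auto simp: card_3_iff)
  have "\<forall>v\<in>r. \<exists>t. \<forall>k<n. v $ k = p $ k + t * (q $ k - p $ k)"
    using r(1) line_through_iff[OF pq] by blast
  then obtain t where t: "\<And>v k. v \<in> r \<Longrightarrow> k < n \<Longrightarrow> v $ k = p $ k + t v * (q $ k - p $ k)"
    by metis
  have inj: "t u \<noteq> t v" if "u \<in> r" "v \<in> r" "u \<noteq> v" for u v
  proof
    assume "t u = t v"
    moreover have "u \<in> carrier_vec n" "v \<in> carrier_vec n"
      using that r(1) line_through_iff[OF pq] by auto
    ultimately have "u = v" using t that by (intro eq_vecI) auto
    then show False using that by simp
  qed
  define a where "a v = (if v = x then t y - t z else if v = y then t z - t x else t x - t y)" for v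
  have "(\<Sum>v\<in>r. a v * v $ k) = 0" if k: "k < n" for k
  proof -
    have eqs: "x $ k = p $ k + t x * (q $ k - p $ k)" "y $ k = p $ k + t y * (q $ k - p $ k)"
      "z $ k = p $ k + t z * (q $ k - p $ k)"
      using t[OF _ k] xyz(1) by blast+
    have "(\<Sum>v\<in>r. a v * v $ k) = (t y - t z) * x $ k + (t z - t x) * y $ k + (t x - t y) * z $ k"
      using xyz by (simp add: a_def)
    also have "\<dots> = 0" unfolding eqs by (simp add: algebra_simps)
    finally show ?thesis .
  qed
  moreover have "\<forall>v\<in>r. a v \<noteq> 0" using inj xyz by (auto simp: a_def)
  ultimately show ?thesis by blast
qed

section \<open>Three-coloured configurations\<close>

text \<open>
  The masses are \<open>1 / card A\<close> on \<open>A\<close> and \<open>1 / card D\<close> on \<open>D = X \<union> Y\<close>. For \<open>p \<in> A\<close>, \<open>q \<in> D\<close> and a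
  further point \<open>r \<in> D\<close> of their line, \<open>\<mu> p \<le> 2 * \<mu> r\<close> and \<open>\<mu> q = \<mu> r\<close> give
  \<open>\<mu> p + \<mu> q \<le> 3 * \<mu> r\<close>, so at least a quarter of the mass of the line is outside \<open>{p, q}\<close>. Points
  joined to \<open>p\<close> in this way have mass at least \<open>\<delta>\<close>; for \<open>p \<in> A\<close> this adds up the points of \<open>X\<close> (the
  third colour being \<open>Y\<close>) and of \<open>Y\<close> (the third colour being \<open>X\<close>). So the configuration is rich with
  \<open>\<eta> = \<delta> / 4\<close> and total mass 2, and \<open>6 * 2\<^sup>2 * 4\<^sup>2 = 384\<close>.
\<close>

lemma dominant_colour_bound:
  fixes A X Y :: "complex vec set" and \<delta> :: real
  assumes fin: "finite A" "finite X" "finite Y"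
    and carr: "A \<subseteq> carrier_vec n" "X \<subseteq> carrier_vec n" "Y \<subseteq> carrier_vec n"
    and disj: "A \<inter> X = {}" "A \<inter> Y = {}" "X \<inter> Y = {}"
    and ne: "A \<noteq> {}" "X \<noteq> {}"
    and small: "card X \<le> card A" "card Y \<le> card A"
    and delta: "\<delta> > 0"
    and AX: "\<And>p. p \<in> A \<Longrightarrow> \<delta> * card X \<le> card {q \<in> X. \<exists>r\<in>Y. r \<in> line_through p q}"
    and AY: "\<And>p. p \<in> A \<Longrightarrow> \<delta> * card Y \<le> card {q \<in> Y. \<exists>r\<in>X. r \<in> line_through p q}"
    and XA: "\<And>p. p \<in> X \<Longrightarrow> \<delta> * card A \<le> card {q \<in> A. \<exists>r\<in>Y. r \<in> line_through p q}"
    and YA: "\<And>p. p \<in> Y \<Longrightarrow> \<delta> * card A \<le> card {q \<in> A. \<exists>r\<in>X. r \<in> line_through p q}"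
  shows "real (vec_space.span_dim n (A \<union> X \<union> Y)) \<le> 384 / \<delta>\<^sup>2"
proof -
  define D where "D = X \<union> Y"
  define T where "T = A \<union> D"
  define l where "l p q = T \<inter> line_through p q" for p q
  define \<mu> where "\<mu> p = (if p \<in> A then 1 / real (card A) else 1 / real (card D))" for p
  have finT: "finite T" "finite D" and Tc: "T \<subseteq> carrier_vec n" and AD: "A \<inter> D = {}"
    using fin carr disj by (auto simp: T_def D_def)
  have a0: "real (card A) > 0" and d0: "real (card D) > 0"
    using ne fin by (auto simp: D_def card_gt_0_iff)
  have cardD: "card D = card X + card Y" using fin disj by (simp add: D_def card_Un_disjoint)
  have d2a: "real (card D) \<le> 2 * real (card A)" using small cardD by simp
  have mu: "\<mu> p > 0" for p using a0 d0 by (simp add: \<mu>_def)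
  have muT: "sum \<mu> T = 2"
  proof -
    have "sum \<mu> T = sum \<mu> A + sum \<mu> D" unfolding T_def using fin finT AD by (intro sum.union_disjoint)
    moreover have "sum \<mu> A = (\<Sum>p\<in>A. 1 / real (card A))" by (intro sum.cong) (auto simp: \<mu>_def)
    moreover have "sum \<mu> D = (\<Sum>p\<in>D. 1 / real (card D))" using AD by (intro sum.cong) (auto simp: \<mu>_def)
    ultimately show ?thesis using a0 d0 by simp
  qed
  have line: "p \<in> l p q \<and> q \<in> l p q \<and> l p q \<subseteq> T" if "p \<in> T" "q \<in> T" for p q
    using that Tc endpoints_in_line_through[of p n q] by (auto simp: l_def)
  have unique: "l x y = l p q" if "p \<in> T" "q \<in> T" "x \<in> l p q" "y \<in> l p q" "x \<noteq> y" for p q x y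
    using that Tc line_through_eq[of p n q x y] by (auto simp: l_def)
  have light: "1 / 4 \<le> 1 - (\<mu> p + \<mu> q) / sum \<mu> (l p q)"
    if p: "p \<in> A" and q: "q \<in> D" and r: "r \<in> D" "r \<noteq> q" "r \<in> l p q" for p q r
  proof -
    have pq: "p \<in> T" "q \<in> T" "p \<noteq> q" "p \<noteq> r" "q \<noteq> r" using p q r AD by (auto simp: T_def)
    have "sum \<mu> {p, q, r} \<le> sum \<mu> (l p q)"
      using line[OF pq(1,2)] r finT less_imp_le[OF mu]
      by (intro sum_mono2) (auto intro: finite_subset)
    then have m: "\<mu> p + \<mu> q + \<mu> r \<le> sum \<mu> (l p q)" using pq by (simp add: add.assoc)
    have v: "\<mu> p = 1 / card A" "\<mu> q = 1 / card D" "\<mu> r = 1 / card D"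
      using p q r AD by (auto simp: \<mu>_def)
    have "\<mu> p \<le> 2 * \<mu> r" unfolding v using d2a a0 d0 by (simp add: field_simps)
    then have "\<mu> p + \<mu> q \<le> 3 / 4 * sum \<mu> (l p q)" using m v(2,3) by linarith
    moreover have "sum \<mu> (l p q) > 0" using m mu[of p] mu[of q] mu[of r] by linarith
    ultimately show ?thesis by (simp add: field_simps)
  qed
  have nonneg: "0 \<le> \<mu> q * (1 - (\<mu> p + \<mu> q) / sum \<mu> (l p q))" if pq: "p \<in> T" "q \<in> T" "p \<noteq> q" for p q
  proof -
    have "sum \<mu> {p, q} \<le> sum \<mu> (l p q)"
      using line[OF pq(1,2)] finT less_imp_le[OF mu] by (intro sum_mono2) (auto intro: finite_subset)
    then have "\<mu> p + \<mu> q \<le> sum \<mu> (l p q)" using pq by simp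
    moreover have "\<mu> p + \<mu> q > 0" using mu[of p] mu[of q] by linarith
    ultimately have "(\<mu> p + \<mu> q) / sum \<mu> (l p q) \<le> 1" by simp
    then show ?thesis using mu[of q] by simp
  qed
  have many: "\<delta> / 4 \<le> (\<Sum>q\<in>T - {p}. \<mu> q * (1 - (\<mu> p + \<mu> q) / sum \<mu> (l p q)))"
    if p: "p \<in> T" and J: "J \<subseteq> T - {p}" and N: "N > 0" "\<delta> * N \<le> real (card J)"
      and val: "\<And>q. q \<in> J \<Longrightarrow> \<mu> q = 1 / N \<and> 1 / 4 \<le> 1 - (\<mu> p + \<mu> q) / sum \<mu> (l p q)" for p J and N :: real
  proof -
    have "\<delta> / 4 \<le> real (card J) * (1 / N * (1 / 4))" using N by (simp add: field_simps)
    also have "\<dots> = (\<Sum>q\<in>J. 1 / N * (1 / 4))" by simp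
    also have "\<dots> \<le> (\<Sum>q\<in>J. \<mu> q * (1 - (\<mu> p + \<mu> q) / sum \<mu> (l p q)))"
    proof (intro sum_mono)
      fix q assume "q \<in> J"
      then have v: "\<mu> q = 1 / N" "1 / 4 \<le> 1 - (\<mu> p + \<mu> q) / sum \<mu> (l p q)" using val by blast+
      have "1 / N * (1 / 4) \<le> 1 / N * (1 - (\<mu> p + \<mu> q) / sum \<mu> (l p q))"
        by (rule mult_left_mono[OF v(2)]) (use N in simp)
      then show "1 / N * (1 / 4) \<le> \<mu> q * (1 - (\<mu> p + \<mu> q) / sum \<mu> (l p q))"
        by (simp only: v(1))
    qed
    also have "\<dots> \<le> (\<Sum>q\<in>T - {p}. \<mu> q * (1 - (\<mu> p + \<mu> q) / sum \<mu> (l p q)))"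
      using J finT p by (intro sum_mono2 nonneg) auto
    finally show ?thesis .
  qed
  have rich: "\<delta> / 4 \<le> (\<Sum>q\<in>T - {p}. \<mu> q * (1 - (\<mu> p + \<mu> q) / sum \<mu> (l p q)))" if p: "p \<in> T" for p
  proof -
    consider "p \<in> A" | "p \<in> X" | "p \<in> Y" using p by (auto simp: T_def D_def)
    then show ?thesis
    proof cases
      case 1
      let ?JX = "{q \<in> X. \<exists>r\<in>Y. r \<in> line_through p q}" and ?JY = "{q \<in> Y. \<exists>r\<in>X. r \<in> line_through p q}"
      show ?thesis
      proof (rule many[OF p, of "?JX \<union> ?JY" "real (card D)"])
        have "card (?JX \<union> ?JY) = card ?JX + card ?JY"
          using fin disj by (intro card_Un_disjoint) auto
        then show "\<delta> * real (card D) \<le> real (card (?JX \<union> ?JY))"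
          using AX[OF 1] AY[OF 1] by (simp add: cardD distrib_left)
        fix q assume q: "q \<in> ?JX \<union> ?JY"
        then obtain r where "r \<in> D" "r \<noteq> q" "r \<in> l p q" "q \<in> D"
          using disj by (auto simp: D_def T_def l_def)
        then show "\<mu> q = 1 / real (card D) \<and> 1 / 4 \<le> 1 - (\<mu> p + \<mu> q) / sum \<mu> (l p q)"
          using light[OF 1, of q r] AD by (auto simp: \<mu>_def)
      qed (use 1 AD d0 in \<open>auto simp: T_def D_def\<close>)
    next
      case 2
      let ?J = "{q \<in> A. \<exists>r\<in>Y. r \<in> line_through p q}"
      show ?thesis
      proof (rule many[OF p, of ?J "real (card A)"])
        fix q assume q: "q \<in> ?J"
        then obtain r where r: "r \<in> D" "r \<noteq> p" "r \<in> l p q"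
          using disj 2 by (auto simp: D_def T_def l_def)
        have "q \<in> T" "q \<noteq> p" using q 2 disj by (auto simp: T_def)
        then have "l q p = l p q" using unique[OF p, of q q p] line[OF p, of q] by auto
        then show "\<mu> q = 1 / real (card A) \<and> 1 / 4 \<le> 1 - (\<mu> p + \<mu> q) / sum \<mu> (l p q)"
          using light[of q p r] r q 2 by (auto simp: \<mu>_def D_def add.commute)
      qed (use 2 XA disj a0 in \<open>auto simp: T_def D_def\<close>)
    next
      case 3
      let ?J = "{q \<in> A. \<exists>r\<in>X. r \<in> line_through p q}"
      show ?thesis
      proof (rule many[OF p, of ?J "real (card A)"])
        fix q assume q: "q \<in> ?J"
        then obtain r where r: "r \<in> D" "r \<noteq> p" "r \<in> l p q"
          using disj 3 by (auto simp: D_def T_def l_def)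
        have "q \<in> T" "q \<noteq> p" using q 3 disj by (auto simp: T_def)
        then have "l q p = l p q" using unique[OF p, of q q p] line[OF p, of q] by auto
        then show "\<mu> q = 1 / real (card A) \<and> 1 / 4 \<le> 1 - (\<mu> p + \<mu> q) / sum \<mu> (l p q)"
          using light[of q p r] r q 3 by (auto simp: \<mu>_def D_def add.commute)
      qed (use 3 YA disj a0 in \<open>auto simp: T_def D_def\<close>)
    qed
  qed
  obtain B :: "complex vec set" and f where finB: "finite B" and cardB: "card B = vec_space.span_dim n T"
    and ind: "independent_family T B f"
    and coord: "\<forall>r a. r \<subseteq> T \<longrightarrow> (\<forall>k<n. (\<Sum>p\<in>r. a p * p $ k) = 0) \<longrightarrow>
      (\<forall>b\<in>B. (\<Sum>p\<in>r. a p * f b p) = 0)"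
    using span_dim_coordinates[OF Tc finT(1)] by (elim exE conjE)
  have "real (card B) \<le> 6 * (sum \<mu> T)\<^sup>2 / (\<delta> / 4)\<^sup>2"
  proof (rule linear_space_rank_bound[OF finT(1) finB, of l])
    fix p q r assume pq: "p \<in> T" "q \<in> T" "p \<noteq> q" and r: "r \<subseteq> l p q" "card r = 3"
    then obtain a where "\<forall>x\<in>r. a x \<noteq> 0" "\<forall>k<n. (\<Sum>x\<in>r. a x * x $ k) = 0"
      using collinear_triple_dependency[of p n q r] Tc by (auto simp: l_def)
    then show "\<exists>a. (\<forall>k\<in>r. a k \<noteq> 0) \<and> (\<forall>b\<in>B. (\<Sum>k\<in>r. a k * f b k) = 0)"
      using coord r by (intro exI[of _ a]) (simp add: l_def)
  next
    fix p q assume "p \<in> T" "q \<in> T"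
    then show "p \<in> l p q \<and> q \<in> l p q \<and> l p q \<subseteq> T" by (rule line)
  next
    fix p q x y assume "p \<in> T" "q \<in> T" "x \<in> l p q" "y \<in> l p q" "x \<noteq> y"
    then show "l x y = l p q" by (rule unique)
  next
    show "\<delta> / 4 > 0" using delta by simp
  qed (rule mu ind rich, assumption?)+
  also have "\<dots> = 384 / \<delta>\<^sup>2" by (simp add: muT power_divide)
  finally show ?thesis by (simp add: cardB T_def D_def Un_assoc)
qed

theorem theorem1p9:
  shows "\<exists>C::real. \<forall>(n::nat) (\<delta>::real) (T :: nat \<Rightarrow> complex vec set).
    0 < \<delta> \<longrightarrow> \<delta> \<le> 1 \<longrightarrow>
    (\<forall>i\<in>{1,2,3}. finite (T i) \<and> T i \<subseteq> carrier_vec n) \<longrightarrow>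
    disjoint_family_on T {1,2,3} \<longrightarrow>
    EK_configuration \<delta> T \<longrightarrow>
    real (vec_space.span_dim n (T 1 \<union> T 2 \<union> T 3)) \<le> C / \<delta> ^ 3"
proof (intro exI[of _ 384] allI impI)
  fix n :: nat and \<delta> :: real and T :: "nat \<Rightarrow> complex vec set"
  assume \<delta>: "0 < \<delta>" "\<delta> \<le> 1" and T: "\<forall>i\<in>{1,2,3}. finite (T i) \<and> T i \<subseteq> carrier_vec n"
    and disj: "disjoint_family_on T {1,2,3}" and EK: "EK_configuration \<delta> T"
  have rich: "T j \<noteq> {}" "\<delta> * card (T j) \<le> card {q \<in> T j. \<exists>r\<in>T k. r \<in> line_through p q}"
    if "{i, j, k} = {1, 2, 3}" "i \<noteq> j" "p \<in> T i" for i j k p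
  proof -
    have "i \<in> {1,2,3}" "j \<in> {1,2,3} - {i}" using that by auto
    then have *: "\<delta> \<le> real (card {q \<in> T j. \<exists>r\<in>T k. r \<in> line_through p q}) / real (card (T j))"
      using EK that unfolding EK_configuration_def by blast
    then show "T j \<noteq> {}" using \<delta> by auto
    then have "card (T j) > 0" using T \<open>j \<in> _\<close> by (auto simp: card_gt_0_iff)
    then show "\<delta> * card (T j) \<le> card {q \<in> T j. \<exists>r\<in>T k. r \<in> line_through p q}"
      using * by (simp add: field_simps)
  qed
  have "\<exists>i j k. {i, j, k} = {1, 2, 3 :: nat} \<and> i \<noteq> j \<and> i \<noteq> k \<and> j \<noteq> k \<and> card (T j) \<le> card (T i) \<and> card (T k) \<le> card (T i)"
  proof -
    consider "card (T 2) \<le> card (T 1)" "card (T 3) \<le> card (T 1)" | "card (T 1) \<le> card (T 2)" "card (T 3) \<le> card (T 2)"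
      | "card (T 1) \<le> card (T 3)" "card (T 2) \<le> card (T 3)" by linarith
    then show ?thesis
    proof cases
      case 1
      then show ?thesis by (intro exI[of _ 1] exI[of _ 2] exI[of _ 3]) auto
    next
      case 2
      then show ?thesis by (intro exI[of _ 2] exI[of _ 1] exI[of _ 3]) auto
    next
      case 3
      then show ?thesis by (intro exI[of _ 3] exI[of _ 1] exI[of _ 2]) auto
    qed
  qed
  then obtain i j k where ijk: "{i, j, k} = {1, 2, 3}" "i \<noteq> j" "i \<noteq> k" "j \<noteq> k"
    and large: "card (T j) \<le> card (T i)" "card (T k) \<le> card (T i)" by blast
  have perm: "{i, k, j} = {1, 2, 3}" "{j, i, k} = {1, 2, 3}" "{k, i, j} = {1, 2, 3}" using ijk(1) by auto
  have mem: "i \<in> {1,2,3}" "j \<in> {1,2,3}" "k \<in> {1,2,3}" using ijk(1) by auto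
  have U: "T 1 \<union> T 2 \<union> T 3 = T i \<union> T j \<union> T k"
  proof -
    have "(\<Union>m\<in>{1,2,3}. T m) = (\<Union>m\<in>{i,j,k}. T m)" using ijk(1) by simp
    then show ?thesis by (simp add: Un_assoc)
  qed
  have dj: "T a \<inter> T b = {}" if "a \<in> {1,2,3}" "b \<in> {1,2,3}" "a \<noteq> b" for a b
    using disj that by (auto simp: disjoint_family_on_def)
  show "real (vec_space.span_dim n (T 1 \<union> T 2 \<union> T 3)) \<le> 384 / \<delta> ^ 3"
  proof (cases "T i = {}")
    case True
    then have "card (T j) = 0" "card (T k) = 0" using large by auto
    then have empty: "T i \<union> T j \<union> T k = {}" using True T mem by auto
    obtain B :: "complex vec set" and f where B: "finite B"
      "card B = vec_space.span_dim n ({} :: complex vec set)" "independent_family ({} :: complex vec set) B f"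
      using span_dim_coordinates[of "{}" n] by auto
    have "real (card B) \<le> 0" using card_fixed_family_le[OF finite.emptyI B(1,3)] by simp
    then show ?thesis using B(2) \<delta> unfolding U empty by simp
  next
    case False
    then obtain p where "p \<in> T i" by blast
    then have "T j \<noteq> {}" using rich(1)[OF ijk(1,2)] by blast
    have "real (vec_space.span_dim n (T i \<union> T j \<union> T k)) \<le> 384 / \<delta>\<^sup>2"
    proof (rule dominant_colour_bound[of "T i" "T j" "T k"])
      show "finite (T i)" "finite (T j)" "finite (T k)"
        "T i \<subseteq> carrier_vec n" "T j \<subseteq> carrier_vec n" "T k \<subseteq> carrier_vec n"
        using T mem by blast+
      show "T i \<inter> T j = {}" "T i \<inter> T k = {}" "T j \<inter> T k = {}"
        using dj[OF mem(1,2)] dj[OF mem(1,3)] dj[OF mem(2,3)] ijk by blast+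
    qed (fact False \<open>T j \<noteq> {}\<close> large \<delta>(1) rich(2)[OF ijk(1,2)] rich(2)[OF perm(1) ijk(3)]
        rich(2)[OF perm(2) ijk(2)[symmetric]] rich(2)[OF perm(3) ijk(3)[symmetric]])+
    also have "\<dots> \<le> 384 / \<delta> ^ 3"
    proof (intro divide_left_mono)
      show "\<delta> ^ 3 \<le> \<delta>\<^sup>2" using \<delta> by (intro power_decreasing) auto
    qed (use \<delta> in auto)
    finally show ?thesis unfolding U .
  qed
qed

end
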